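(* Let $G$ be a connected topological group and $A$ a topological $G$-module. Suppose that the cocycle $f\in C^{n}_{\mathrm{loc},\mathrm{top}}(G,A)$ is continuous on the identity neighborhood $U\subseteq G^{n}$ and let $V\subseteq G$ be open such that $e\in V$ and $V^{2}\times\cdots\times V^{2}\subseteq U$. Then the map $$\tau(f)_{g_{1},\ldots,g_{n}}\colon g_{1}V\cap\cdots\cap g_{n}V\to A,\quad x\mapsto g_{1}.f(g_{1}^{-1}g_{2},\ldots,g_{n-1}^{-1}g_{n},g_{n}^{-1}x)-(-1)^{n}f(g_{1},g_{1}^{-1}g_{2},\ldots,g_{n-1}^{-1}g_{n})$$ defines a continuous Čech $(n-1)$-cocycle on the open cover $(gV)_{g\in G}$. Moreover, this induces a well-defined map $$\tau_{n}\colon H^{n}_{\mathrm{loc},\mathrm{top}}(G,A)\to\check{H}^{n-1}(|G|,\underline{A}),\quad [f]\mapsto[\tau(f)],$$ which is a morphism of $\delta$-functors.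
   Context: Topological groups and topological $G$-modules are taken with respect to the product topology. $C^n_{\mathrm{loc},\mathrm{top}}(G,A)$ is the group of all maps $f\colon G^n\to A$ that are continuous on some neighborhood of the identity of $G^n$ (product topology); $H^n_{\mathrm{loc},\mathrm{top}}(G,A)$ is the cohomology of this complex with the differential $(\mathtt{d}_{\mathrm{gp}} f)(g_0,\ldots,g_n)=g_0.f(g_1,\ldots,g_n)+\sum_{j=1}^n(-1)^jf(g_0,\ldots,g_{j-1}g_j,\ldots,g_n)+(-1)^{n+1}f(g_0,\ldots,g_{n-1})$. $|G|$ is the underlying space of $G$, $\underline A$ the sheaf of continuous $A$-valued functions on it, and $\check H^*$ is Čech cohomology. A short exact sequence of topological $G$-modules is a sequence $A\to B\to C$ that is exact as a sequence of abelian groups and is a locally trivial principal $A$-bundle. That $\tau$ is a morphism of $\delta$-functors means that for every such sequence $\tau_{n+1}\circ\delta_n=\delta_{n-1}\circ\tau_n$ as maps $H^n_{\mathrm{loc},\mathrm{top}}(G,C)\to\check H^n(|G|,\underline A)$. Here the connecting homomorphism $\delta_n\colon H^n_{\mathrm{loc},\mathrm{top}}(G,C)\to H^{n+1}_{\mathrm{loc},\mathrm{top}}(G,A)$ sends $[f]$ to $[\mathtt{d}_{\mathrm{gp}}\tilde f]$ for a lift $\tilde f\in C^n_{\mathrm{loc},\mathrm{top}}(G,B)$ of $f$; the connecting homomorphism $\delta_{n-1}\colon\check H^{n-1}(|G|,\underline C)\to\check H^{n}(|G|,\underline A)$ is likewise given by lifting a continuous Čech cocycle to a continuous $B$-valued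 cochain and applying the Čech differential.
   Formalization: n≥1; for n≥3, V is assumed symmetric (else τ(f) can be discontinuous); τ_1 is defined on classes only for trivial action (coboundaries x.a−a give nonzero functions); the Čech connecting map is a relation via some liftable representative, as it need not be a map. *)

theory Defs
  imports "HOL-Analysis.Analysis"
begin

(* Topological groups are types of class topological_group_add: the group law is written +, the
   identity 0 and inverses -g, but + is NOT assumed commutative.  So "- g + h" is g^{-1}h and
   "(+) g ` V" is the left translate gV.  No separation axiom is assumed. *)

definition tuples :: "nat \<Rightarrow> (nat \<Rightarrow> 'x) set" where
  "tuples n = {..<n} \<rightarrow>\<^sub>E UNIV"

definition pow_top :: "nat \<Rightarrow> (nat \<Rightarrow> 'x::topological_space) topology" where
  "pow_top n = product_topology (\<lambda>_. euclidean) {..<n}"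

definition alt :: "nat \<Rightarrow> 'a::ab_group_add \<Rightarrow> 'a" where
  "alt j a = (if even j then a else - a)"

section \<open>Topological modules\<close>

definition top_module ::
  "('g::topological_group_add \<Rightarrow> 'a::topological_ab_group_add \<Rightarrow> 'a) \<Rightarrow> bool" where
  "top_module act \<longleftrightarrow>
     (\<forall>a. act 0 a = a) \<and>
     (\<forall>g h a. act (g + h) a = act g (act h a)) \<and>
     (\<forall>g a b. act g (a + b) = act g a + act g b) \<and>
     continuous_on UNIV (\<lambda>(g, a). act g a)"

definition module_morphism ::
  "('g::topological_group_add \<Rightarrow> 'a::topological_ab_group_add \<Rightarrow> 'a) \<Rightarrow>
   ('g \<Rightarrow> 'b::topological_ab_group_add \<Rightarrow> 'b) \<Rightarrow> ('a \<Rightarrow> 'b) \<Rightarrow> bool" where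
  "module_morphism actA actB \<phi> \<longleftrightarrow>
     (\<forall>a a'. \<phi> (a + a') = \<phi> a + \<phi> a') \<and>
     (\<forall>g a. \<phi> (actA g a) = actB g (\<phi> a)) \<and>
     continuous_on UNIV \<phi>"

(* The last conjunct says that p is a locally trivial principal 'a-bundle, where a acts on the
   total space by b \<mapsto> b + i a: over a neighbourhood W of each point there is an equivariant
   trivialization \<phi> over W. *)
definition short_exact ::
  "('g::topological_group_add \<Rightarrow> 'a::topological_ab_group_add \<Rightarrow> 'a) \<Rightarrow>
   ('g \<Rightarrow> 'b::topological_ab_group_add \<Rightarrow> 'b) \<Rightarrow>
   ('g \<Rightarrow> 'c::topological_ab_group_add \<Rightarrow> 'c) \<Rightarrow> ('a \<Rightarrow> 'b) \<Rightarrow> ('b \<Rightarrow> 'c) \<Rightarrow> bool" where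
  "short_exact actA actB actC i p \<longleftrightarrow>
     top_module actA \<and> top_module actB \<and> top_module actC \<and>
     module_morphism actA actB i \<and> module_morphism actB actC p \<and>
     inj i \<and> range i = {b. p b = 0} \<and> surj p \<and>
     (\<forall>c. \<exists>W \<phi> \<psi>. open W \<and> c \<in> W \<and> homeomorphism (W \<times> UNIV) (p -` W) \<phi> \<psi> \<and>
        (\<forall>w\<in>W. \<forall>a. p (\<phi> (w, a)) = w) \<and>
        (\<forall>w\<in>W. \<forall>a a'. \<phi> (w, a + a') = \<phi> (w, a) + i a'))"

section \<open>Locally continuous group cohomology\<close>

(* An n-cochain is a function on all of nat \<Rightarrow> 'g of which only the values on "tuples n" matter;
   cohomologous cocycles are compared on "tuples n" only. *)

definition identity_nbhd :: "nat \<Rightarrow> (nat \<Rightarrow> 'g::topological_group_add) set \<Rightarrow> bool" where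
  "identity_nbhd n U \<longleftrightarrow>
     U \<subseteq> tuples n \<and> (\<exists>W. openin (pow_top n) W \<and> (\<lambda>i\<in>{..<n}. 0) \<in> W \<and> W \<subseteq> U)"

definition continuous_on_nbhd ::
  "nat \<Rightarrow> (nat \<Rightarrow> 'g::topological_group_add) set \<Rightarrow>
   ((nat \<Rightarrow> 'g) \<Rightarrow> 'a::topological_ab_group_add) \<Rightarrow> bool" where
  "continuous_on_nbhd n U f \<longleftrightarrow>
     identity_nbhd n U \<and> continuous_map (subtopology (pow_top n) U) euclidean f"

definition loc_cochain ::
  "nat \<Rightarrow> ((nat \<Rightarrow> 'g::topological_group_add) \<Rightarrow> 'a::topological_ab_group_add) \<Rightarrow> bool" where
  "loc_cochain n f \<longleftrightarrow> (\<exists>U. continuous_on_nbhd n U f)"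

definition gp_diff ::
  "('g::topological_group_add \<Rightarrow> 'a::topological_ab_group_add \<Rightarrow> 'a) \<Rightarrow> nat \<Rightarrow>
   ((nat \<Rightarrow> 'g) \<Rightarrow> 'a) \<Rightarrow> (nat \<Rightarrow> 'g) \<Rightarrow> 'a" where
  "gp_diff act n f g =
     act (g 0) (f (\<lambda>i\<in>{..<n}. g (Suc i)))
     + (\<Sum>j=1..n. alt j (f (\<lambda>i\<in>{..<n}.
          if i < j - 1 then g i else if i = j - 1 then g (j - 1) + g j else g (Suc i))))
     + alt (Suc n) (f (\<lambda>i\<in>{..<n}. g i))"

definition loc_cocycle ::
  "('g::topological_group_add \<Rightarrow> 'a::topological_ab_group_add \<Rightarrow> 'a) \<Rightarrow> nat \<Rightarrow>
   ((nat \<Rightarrow> 'g) \<Rightarrow> 'a) \<Rightarrow> bool" where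
  "loc_cocycle act n f \<longleftrightarrow> loc_cochain n f \<and> (\<forall>g\<in>tuples (Suc n). gp_diff act n f g = 0)"

definition loc_coboundary ::
  "('g::topological_group_add \<Rightarrow> 'a::topological_ab_group_add \<Rightarrow> 'a) \<Rightarrow> nat \<Rightarrow>
   ((nat \<Rightarrow> 'g) \<Rightarrow> 'a) \<Rightarrow> bool" where
  "loc_coboundary act n f \<longleftrightarrow>
     (case n of
        0 \<Rightarrow> (\<forall>g\<in>tuples n. f g = 0)
      | Suc m \<Rightarrow> (\<exists>h. loc_cochain m h \<and> (\<forall>g\<in>tuples n. f g = gp_diff act m h g)))"

definition loc_cohomologous ::
  "('g::topological_group_add \<Rightarrow> 'a::topological_ab_group_add \<Rightarrow> 'a) \<Rightarrow> nat \<Rightarrow>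
   (((nat \<Rightarrow> 'g) \<Rightarrow> 'a) \<times> ((nat \<Rightarrow> 'g) \<Rightarrow> 'a)) set" where
  "loc_cohomologous act n =
     {(f, f'). loc_cocycle act n f \<and> loc_cocycle act n f' \<and>
               loc_coboundary act n (\<lambda>g. f' g - f g)}"

definition loc_cohomology ::
  "('g::topological_group_add \<Rightarrow> 'a::topological_ab_group_add \<Rightarrow> 'a) \<Rightarrow> nat \<Rightarrow>
   ((nat \<Rightarrow> 'g) \<Rightarrow> 'a) set set" where
  "loc_cohomology act n = {f. loc_cocycle act n f} // loc_cohomologous act n"

definition loc_class ::
  "('g::topological_group_add \<Rightarrow> 'a::topological_ab_group_add \<Rightarrow> 'a) \<Rightarrow> nat \<Rightarrow>
   ((nat \<Rightarrow> 'g) \<Rightarrow> 'a) \<Rightarrow> ((nat \<Rightarrow> 'g) \<Rightarrow> 'a) set" where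
  "loc_class act n f = loc_cohomologous act n `` {f}"

(* [f] \<mapsto> [d f~].  The set of all cocycles h representing d f~, for all representatives f of \<xi> and
   all lifts f~ of f, is a full cohomology class, since adding d k to h amounts to adding i k
   to f~. *)
definition gp_connecting ::
  "('g::topological_group_add \<Rightarrow> 'a::topological_ab_group_add \<Rightarrow> 'a) \<Rightarrow>
   ('g \<Rightarrow> 'b::topological_ab_group_add \<Rightarrow> 'b) \<Rightarrow> ('a \<Rightarrow> 'b) \<Rightarrow>
   ('b \<Rightarrow> 'c::topological_ab_group_add) \<Rightarrow> nat \<Rightarrow>
   ((nat \<Rightarrow> 'g) \<Rightarrow> 'c) set \<Rightarrow> ((nat \<Rightarrow> 'g) \<Rightarrow> 'a) set" where
  "gp_connecting actA actB i p n \<xi> =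
     {h. loc_cocycle actA (Suc n) h \<and>
         (\<exists>f\<in>\<xi>. \<exists>ft. loc_cochain n ft \<and> (\<forall>g\<in>tuples n. p (ft g) = f g) \<and>
            (\<forall>g\<in>tuples (Suc n). i (h g) = gp_diff actB n ft g))}"

section \<open>Cech cohomology with coefficients in the sheaf of continuous functions\<close>

(* Open covers of a space are families indexed by the points of the space.  Such covers are cofinal
   among all open covers (choose for every point a member containing it), so the colimit over
   refinements does not change, and it can be formed inside HOL.  A Cech p-cochain is indexed by
   the elements of "tuples (Suc p)", and only its values there, at points of the respective
   intersections, matter. *)

definition open_cover :: "('x::topological_space \<Rightarrow> 'x set) \<Rightarrow> bool" where
  "open_cover U \<longleftrightarrow> (\<forall>j. open (U j)) \<and> (\<Union>j. U j) = UNIV"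

definition cech_inter :: "('x \<Rightarrow> 'x set) \<Rightarrow> nat \<Rightarrow> (nat \<Rightarrow> 'x) \<Rightarrow> 'x set" where
  "cech_inter U k g = (\<Inter>j\<in>{..k}. U (g j))"

definition cech_cochain ::
  "('x::topological_space \<Rightarrow> 'x set) \<Rightarrow> nat \<Rightarrow>
   ((nat \<Rightarrow> 'x) \<Rightarrow> 'x \<Rightarrow> 'a::topological_ab_group_add) \<Rightarrow> bool" where
  "cech_cochain U k c \<longleftrightarrow> (\<forall>g\<in>tuples (Suc k). continuous_on (cech_inter U k g) (c g))"

definition cech_diff ::
  "nat \<Rightarrow> ((nat \<Rightarrow> 'x) \<Rightarrow> 'x \<Rightarrow> 'a::topological_ab_group_add) \<Rightarrow> (nat \<Rightarrow> 'x) \<Rightarrow> 'x \<Rightarrow> 'a" where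
  "cech_diff k c g x =
     (\<Sum>j\<in>{..Suc k}. alt j (c (\<lambda>i\<in>{..<Suc k}. if i < j then g i else g (Suc i)) x))"

definition cech_cocycle ::
  "('x::topological_space \<Rightarrow> 'x set) \<Rightarrow> nat \<Rightarrow>
   ((nat \<Rightarrow> 'x) \<Rightarrow> 'x \<Rightarrow> 'a::topological_ab_group_add) \<Rightarrow> bool" where
  "cech_cocycle U k c \<longleftrightarrow> cech_cochain U k c \<and>
     (\<forall>g\<in>tuples (Suc (Suc k)). \<forall>x\<in>cech_inter U (Suc k) g. cech_diff k c g x = 0)"

definition cech_coboundary ::
  "('x::topological_space \<Rightarrow> 'x set) \<Rightarrow> nat \<Rightarrow>
   ((nat \<Rightarrow> 'x) \<Rightarrow> 'x \<Rightarrow> 'a::topological_ab_group_add) \<Rightarrow> bool" where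
  "cech_coboundary U k c \<longleftrightarrow>
     (case k of
        0 \<Rightarrow> (\<forall>g\<in>tuples (Suc k). \<forall>x\<in>cech_inter U k g. c g x = 0)
      | Suc m \<Rightarrow> (\<exists>b. cech_cochain U m b \<and>
          (\<forall>g\<in>tuples (Suc k). \<forall>x\<in>cech_inter U k g. c g x = cech_diff m b g x)))"

(* A Cech class is an element of the colimit, over all open covers U and all refinements, of the
   cohomology groups for U: a class of pairs (U, c) under the equivalence relation generated by
   adding coboundaries and by pulling back along a refinement map r. *)
inductive cech_step ::
  "nat \<Rightarrow> ('x::topological_space \<Rightarrow> 'x set) \<times> ((nat \<Rightarrow> 'x) \<Rightarrow> 'x \<Rightarrow> 'a::topological_ab_group_add) \<Rightarrow>
   ('x \<Rightarrow> 'x set) \<times> ((nat \<Rightarrow> 'x) \<Rightarrow> 'x \<Rightarrow> 'a) \<Rightarrow> bool"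
  for k :: nat where
  cohomologous:
    "open_cover U \<Longrightarrow> cech_cocycle U k c \<Longrightarrow> cech_cocycle U k c' \<Longrightarrow>
     cech_coboundary U k (\<lambda>g x. c' g x - c g x) \<Longrightarrow> cech_step k (U, c) (U, c')"
| refine:
    "open_cover U \<Longrightarrow> cech_cocycle U k c \<Longrightarrow> open_cover W \<Longrightarrow> (\<And>j. W j \<subseteq> U (r j)) \<Longrightarrow>
     cech_step k (U, c) (W, \<lambda>g. c (\<lambda>j\<in>{..<Suc k}. r (g j)))"

definition cech_class ::
  "nat \<Rightarrow> ('x::topological_space \<Rightarrow> 'x set) \<Rightarrow>
   ((nat \<Rightarrow> 'x) \<Rightarrow> 'x \<Rightarrow> 'a::topological_ab_group_add) \<Rightarrow>
   (('x \<Rightarrow> 'x set) \<times> ((nat \<Rightarrow> 'x) \<Rightarrow> 'x \<Rightarrow> 'a)) set" where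
  "cech_class k U c = {(U', c'). equivclp (cech_step k) (U, c) (U', c')}"

definition cech_cohomology ::
  "nat \<Rightarrow> (('x::topological_space \<Rightarrow> 'x set) \<times>
           ((nat \<Rightarrow> 'x) \<Rightarrow> 'x \<Rightarrow> 'a::topological_ab_group_add)) set set" where
  "cech_cohomology k = {cech_class k U c | U c. open_cover U \<and> cech_cocycle U k c}"

(* b is a continuous lift of the cocycle c, and the 'a-valued cocycle a is the differential of b. *)
definition cech_lift ::
  "('a::topological_ab_group_add \<Rightarrow> 'b::topological_ab_group_add) \<Rightarrow>
   ('b \<Rightarrow> 'c::topological_ab_group_add) \<Rightarrow> nat \<Rightarrow> ('x::topological_space \<Rightarrow> 'x set) \<Rightarrow>
   ((nat \<Rightarrow> 'x) \<Rightarrow> 'x \<Rightarrow> 'c) \<Rightarrow> ((nat \<Rightarrow> 'x) \<Rightarrow> 'x \<Rightarrow> 'b) \<Rightarrow> ((nat \<Rightarrow> 'x) \<Rightarrow> 'x \<Rightarrow> 'a) \<Rightarrow> bool" where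
  "cech_lift i p k U c b a \<longleftrightarrow>
     cech_cocycle U k c \<and> cech_cochain U k b \<and> cech_cocycle U (Suc k) a \<and>
     (\<forall>g\<in>tuples (Suc k). \<forall>x\<in>cech_inter U k g. p (b g x) = c g x) \<and>
     (\<forall>g\<in>tuples (Suc (Suc k)). \<forall>x\<in>cech_inter U (Suc k) g. i (a g x) = cech_diff k b g x)"

(* The graph of the connecting homomorphism, \<alpha> \<mapsto> \<beta>, in degree k.  It is a relation because, without
   paracompactness of the space, a class need not have a representative that lifts continuously,
   nor need its image be unique; wherever the connecting homomorphism is defined, the relation
   says that it sends \<alpha> to \<beta>. *)
definition cech_connecting ::
  "('a::topological_ab_group_add \<Rightarrow> 'b::topological_ab_group_add) \<Rightarrow>
   ('b \<Rightarrow> 'c::topological_ab_group_add) \<Rightarrow> nat \<Rightarrow>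
   (('x::topological_space \<Rightarrow> 'x set) \<times> ((nat \<Rightarrow> 'x) \<Rightarrow> 'x \<Rightarrow> 'c)) set \<Rightarrow>
   (('x \<Rightarrow> 'x set) \<times> ((nat \<Rightarrow> 'x) \<Rightarrow> 'x \<Rightarrow> 'a)) set \<Rightarrow> bool" where
  "cech_connecting i p k \<alpha> \<beta> \<longleftrightarrow>
     (\<exists>U c b a. open_cover U \<and> cech_lift i p k U c b a \<and>
        \<alpha> = cech_class k U c \<and> \<beta> = cech_class (Suc k) U a)"

section \<open>The comparison map\<close>

definition translates :: "'g::topological_group_add set \<Rightarrow> 'g \<Rightarrow> 'g set" where
  "translates V g = (+) g ` V"

(* On the intersection of the g_j V the arguments g_j^{-1} g_{j+1} lie in V V^{-1}, which is
   contained in V^2 when V is symmetric.  For n \<le> 2 symmetry is not needed; for n \<ge> 3 the cochains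
   tau f can be discontinuous without it. *)
definition tau_nbhds ::
  "nat \<Rightarrow> ((nat \<Rightarrow> 'g::topological_group_add) \<Rightarrow> 'a::topological_ab_group_add) \<Rightarrow>
   (nat \<Rightarrow> 'g) set \<Rightarrow> 'g set \<Rightarrow> bool" where
  "tau_nbhds n f U V \<longleftrightarrow>
     continuous_on_nbhd n U f \<and> open V \<and> 0 \<in> V \<and>
     ({..<n} \<rightarrow>\<^sub>E {v + w | v w. v \<in> V \<and> w \<in> V}) \<subseteq> U \<and>
     (3 \<le> n \<longrightarrow> uminus ` V = V)"

(* The tuple (g_1, ..., g_n) indexing the cochain is g 0, ..., g (n - 1). *)
definition tau ::
  "('g::topological_group_add \<Rightarrow> 'a::topological_ab_group_add \<Rightarrow> 'a) \<Rightarrow> nat \<Rightarrow>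
   ((nat \<Rightarrow> 'g) \<Rightarrow> 'a) \<Rightarrow> (nat \<Rightarrow> 'g) \<Rightarrow> 'g \<Rightarrow> 'a" where
  "tau act n f g x =
     act (g 0) (f (\<lambda>i\<in>{..<n}. if Suc i < n then - g i + g (Suc i) else - g i + x))
     - alt n (f (\<lambda>i\<in>{..<n}. if i = 0 then g 0 else - g (i - 1) + g i))"

(* A map out of a quotient, as usual the union of its values on representatives; it is meaningful
   when all these values agree. *)
definition tau_map ::
  "('g::topological_group_add \<Rightarrow> 'a::topological_ab_group_add \<Rightarrow> 'a) \<Rightarrow> nat \<Rightarrow>
   ((nat \<Rightarrow> 'g) \<Rightarrow> 'a) set \<Rightarrow> (('g \<Rightarrow> 'g set) \<times> ((nat \<Rightarrow> 'g) \<Rightarrow> 'g \<Rightarrow> 'a)) set" where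
  "tau_map act n \<xi> =
     (\<Union>f\<in>\<xi>. \<Union>V\<in>{V. \<exists>U. tau_nbhds n f U V}. cech_class (n - 1) (translates V) (tau act n f))"

end

(* For a cochain f let F (g_0, ..., g_n) = g_0 . f (g_0^{-1} g_1, ..., g_{n-1}^{-1} g_n); in these
   homogeneous terms the group differential is the alternating sum over omitted arguments, and
   tau f = F (g_1, ..., g_n, x) - (-1)^n F (1, g_1, ..., g_n).  Writing out this sum for the tuples
   (g_1, ..., g_{n+1}, x) and (1, g_1, ..., g_{n+1}), the terms omitting x and 1 cancel, which gives
   tau (d f) = d (tau f), with the Cech differential on the right, for every cochain f, continuous
   or not.  Hence tau maps cocycles to cocycles and coboundaries to coboundaries, the latter for
   n >= 2 only: for n = 1 the coboundary of h in A becomes the function x |-> x . h - h.  Applied to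
   a lift of f along B -> C, the same identity shows that tau commutes with the connecting
   homomorphisms. *)

theory Submission
  imports Defs
begin

section \<open>Alternating sums and the homogeneous picture\<close>

text \<open>What remains beside this algebra is topology. A cochain is continuous only near the
  identity, so a cover must be found on which its \<open>tau\<close> is continuous. The second
  summand of \<open>tau\<close>, whose arguments may be far from the identity, is harmless because
  it does not depend on x. All covers in use are indexed by G itself, so results obtained for
  different V are compared on the translates of an intersection, refining along the identity of
  indices. The bundle B -> C enters in two ways. To lift a group cochain, a section of p near its
  value at the identity is enough; elsewhere any preimages serve. To get back from B to A, a
  trivialization near 0 is turned into a continuous left inverse of i on an open neighbourhood of
  its range. This makes the cocycle representing d of a lift locally continuous, and it makes the
  difference of two Cech lifts continuous as an A-valued cochain. The Cech lift that the connecting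
  homomorphism asks for is not obtained from paracompactness: it is \<open>tau\<close> of a lift of
  the group cocycle.\<close>

lemma alt_0 [simp]: "alt j 0 = 0"
  by (simp add: alt_def)

lemma alt_zero [simp]: "alt 0 a = a"
  by (simp add: alt_def)

lemma alt_Suc [simp]: "alt (Suc j) a = - alt j a"
  by (simp add: alt_def)

lemma alt_diff: "alt j (a - b) = alt j a - alt j b"
  by (simp add: alt_def)

lemma alt_minus [simp]: "alt j (- a) = - alt j a"
  by (simp add: alt_def)

lemma alt_commute: "alt j (alt k a) = alt k (alt j a)"
  by (simp add: alt_def)

lemma alt_sum: "alt j (\<Sum>x\<in>X. u x) = (\<Sum>x\<in>X. alt j (u x))"
  by (simp add: alt_def sum_negf)

lemma additive_alt:
  fixes \<phi> :: "'a::ab_group_add \<Rightarrow> 'b::ab_group_add"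
  assumes "Modules.additive \<phi>"
  shows "\<phi> (alt j a) = alt j (\<phi> a)"
  using Modules.additive.minus[OF assms] by (simp add: alt_def)

lemma restrict_in_tuples [simp]: "restrict u {..<n} \<in> tuples n"
  by (simp add: tuples_def)

lemma restrict_tuples: "g \<in> tuples n \<Longrightarrow> restrict g {..<n} = g"
  by (simp add: tuples_def PiE_restrict)

text \<open>Defined on infinite sequences, so that faces compose with no bookkeeping of lengths;
  cochains read only finitely many entries.\<close>

definition face :: "nat \<Rightarrow> (nat \<Rightarrow> 'x) \<Rightarrow> nat \<Rightarrow> 'x" where
  "face j q i = (if i < j then q i else q (Suc i))"

lemma cech_diff_face:
  "cech_diff k c g x = (\<Sum>j\<in>{..Suc k}. alt j (c (restrict (face j g) {..<Suc k}) x))"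
  by (simp add: cech_diff_def face_def [abs_def])

lemma face_face: "i \<le> j \<Longrightarrow> face i (face (Suc j) q) = face j (face i q)"
  by (auto simp: face_def fun_eq_iff)

text \<open>The terms cancel in pairs: (j, i) with i < j is matched with (i, j - 1). Both have the
  same double face by the simplicial identity \<open>face_face\<close>, and their signs differ by
  one step.\<close>

lemma alternating_face_sum_twice:
  fixes F :: "(nat \<Rightarrow> 'x) \<Rightarrow> 'a::ab_group_add"
  shows "(\<Sum>j\<le>Suc k. alt j (\<Sum>i\<le>k. alt i (F (face i (face j q))))) = 0"
proof -
  let ?t = "\<lambda>(j, i). alt j (alt i (F (face i (face j q))))"
  let ?D = "{..Suc k} \<times> {..k}"
  let ?L = "{x \<in> ?D. snd x < fst x}" and ?R = "{x \<in> ?D. \<not> snd x < fst x}"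
  have "(\<Sum>j\<le>Suc k. alt j (\<Sum>i\<le>k. alt i (F (face i (face j q))))) = sum ?t ?D"
    by (simp only: alt_sum sum.cartesian_product)
  also have "\<dots> = sum ?t (?L \<union> ?R)"
    by (rule sum.cong) auto
  also have "\<dots> = sum ?t ?L + sum ?t ?R"
    by (rule sum.union_disjoint) auto
  also have "sum ?t ?L = (\<Sum>x\<in>?R. - ?t x)"
  proof (rule sum.reindex_bij_witness[where i = "\<lambda>(j, i). (Suc i, j)" and j = "\<lambda>(j, i). (i, j - 1)"],
      goal_cases)
    case (5 x)
    then obtain j i where "x = (Suc j, i)" "i \<le> j"
      by (cases x; cases "fst x") auto
    then show ?case
      by (simp add: face_face alt_commute[of j i])
  qed auto
  finally show ?thesis
    by (simp add: sum_negf)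
qed

text \<open>Only the entries 0, ..., n of the sequence are read, so x can be appended and 0
  prepended without forming tuples of a new length.\<close>

definition hom_cochain :: "('g::group_add \<Rightarrow> 'a \<Rightarrow> 'a) \<Rightarrow> nat \<Rightarrow> ((nat \<Rightarrow> 'g) \<Rightarrow> 'a) \<Rightarrow> (nat \<Rightarrow> 'g) \<Rightarrow> 'a"
  where "hom_cochain act n f q = act (q 0) (f (\<lambda>i\<in>{..<n}. - q i + q (Suc i)))"

lemma hom_cochain_cong:
  "(\<And>i. i \<le> n \<Longrightarrow> q i = q' i) \<Longrightarrow> hom_cochain act n f q = hom_cochain act n f q'"
  by (simp add: hom_cochain_def cong: restrict_cong)

lemma top_module_additive: "top_module act \<Longrightarrow> Modules.additive (act g)"
  by (simp add: top_module_def Modules.additive_def)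

text \<open>For the consecutive quotients g of q, multiplying g (j - 1) by g j deletes q j, the
  action of g 0 deletes q 0 because q 0 + g 0 = q 1, and dropping the last entry deletes q (Suc
  n).\<close>

lemma hom_cochain_gp_diff:
  assumes "top_module act"
  shows "hom_cochain act (Suc n) (gp_diff act n f) q =
    (\<Sum>j\<le>Suc n. alt j (hom_cochain act n f (face j q)))"
proof -
  interpret Modules.additive "act (q 0)"
    using assms by (rule top_module_additive)
  have act_add: "act g (act h a) = act (g + h) a" for g h a
    using assms by (simp add: top_module_def)
  define g where "g = (\<lambda>i\<in>{..<Suc n}. - q i + q (Suc i))"
  have 0: "act (q 0) (act (g 0) (f (\<lambda>i\<in>{..<n}. g (Suc i)))) = alt 0 (hom_cochain act n f (face 0 q))"
    by (simp add: hom_cochain_def g_def act_add face_def[abs_def] cong: restrict_cong)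
  have j: "act (q 0) (f (\<lambda>i\<in>{..<n}. if i < j - 1 then g i else if i = j - 1 then g (j - 1) + g j else g (Suc i)))
      = hom_cochain act n f (face j q)" if "j \<in> {1..n}" for j
  proof -
    have eq: "(\<lambda>i\<in>{..<n}. if i < j - 1 then g i else if i = j - 1 then g (j - 1) + g j else g (Suc i))
        = (\<lambda>i\<in>{..<n}. - face j q i + face j q (Suc i))" (is "?l = ?r")
    proof
      fix i
      show "?l i = ?r i"
        using that by (cases j) (auto simp: g_def face_def add.assoc[symmetric])
    qed
    show ?thesis
      unfolding eq hom_cochain_def using that by (simp add: face_def)
  qed
  have n: "act (q 0) (f (\<lambda>i\<in>{..<n}. g i)) = hom_cochain act n f (face (Suc n) q)"
    by (simp add: hom_cochain_def g_def face_def cong: restrict_cong)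
  have "hom_cochain act (Suc n) (gp_diff act n f) q = alt 0 (hom_cochain act n f (face 0 q))
      + (\<Sum>j=1..n. alt j (hom_cochain act n f (face j q))) + alt (Suc n) (hom_cochain act n f (face (Suc n) q))"
    unfolding hom_cochain_def[of act "Suc n"] g_def[symmetric] gp_diff_def[of act n f g]
    by (simp only: add sum additive_alt[OF top_module_additive[OF assms]] 0 j n cong: sum.cong)
  also have "\<dots> = (\<Sum>j\<le>Suc n. alt j (hom_cochain act n f (face j q)))"
    by (simp add: atMost_atLeast0 sum.atLeast_Suc_atMost)
  finally show ?thesis .
qed

lemma gp_diff_cong:
  "(\<And>g. g \<in> tuples n \<Longrightarrow> f g = f' g) \<Longrightarrow> gp_diff act n f g = gp_diff act n f' g"
  by (simp add: gp_diff_def)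

lemma tau_cong:
  "(\<And>g. g \<in> tuples n \<Longrightarrow> f g = f' g) \<Longrightarrow> tau act n f g x = tau act n f' g x"
  by (simp add: tau_def)

lemma gp_diff_gp_diff:
  assumes "top_module act" and g: "g \<in> tuples (Suc (Suc n))"
  shows "gp_diff act (Suc n) (gp_diff act n f) g = 0"
proof -
  \<comment> \<open>The partial products of g: their consecutive quotients are the entries of g, and
    the leading action by q 0 = 0 is trivial. The inhomogeneous value thus becomes a homogeneous
    one.\<close>
  define q where "q = rec_nat 0 (\<lambda>i s. s + g i)"
  have q: "q 0 = 0" "- q i + q (Suc i) = g i" for i
    by (auto simp: q_def)
  have "gp_diff act (Suc n) (gp_diff act n f) g
      = hom_cochain act (Suc (Suc n)) (gp_diff act (Suc n) (gp_diff act n f)) q"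
    using assms(1) by (simp add: hom_cochain_def q restrict_tuples[OF g] top_module_def)
  also have "\<dots> = 0"
    unfolding hom_cochain_gp_diff[OF assms(1)] by (rule alternating_face_sum_twice)
  finally show ?thesis .
qed

lemma tau_hom_cochain:
  assumes "top_module act"
  shows "tau act (Suc m) f g x = hom_cochain act (Suc m) f (\<lambda>i. if i < Suc m then g i else x)
    - alt (Suc m) (hom_cochain act (Suc m) f (case_nat 0 g))"
proof -
  have *: "(\<lambda>i\<in>{..<Suc m}. if i = 0 then g 0 else - g (i - 1) + g i)
     = (\<lambda>i\<in>{..<Suc m}. - case_nat 0 g i + case_nat 0 g (Suc i))"
    by (auto split: nat.split)
  have **: "(\<lambda>i\<in>{..<Suc m}. if Suc i < Suc m then - g i + g (Suc i) else - g i + x)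
     = (\<lambda>i\<in>{..<Suc m}. - (if i < Suc m then g i else x) + (if Suc i < Suc m then g (Suc i) else x))"
    by auto
  show ?thesis
    using assms unfolding tau_def hom_cochain_def * ** by (simp add: top_module_def)
qed

lemma tau_gp_diff:
  assumes "top_module act"
  shows "tau act (Suc (Suc m)) (gp_diff act (Suc m) f) g x = cech_diff m (tau act (Suc m) f) g x"
proof -
  let ?n = "Suc m" and ?F = "hom_cochain act (Suc m) f"
  let ?s = "\<lambda>n u i. if i < n then u i else x"
  have snoc: "?F (face j (?s (Suc ?n) g)) = ?F (?s ?n (restrict (face j g) {..<?n}))" if "j \<le> ?n" for j
    using that by (intro hom_cochain_cong) (auto simp: face_def)
  have snoc_last: "?F (face (Suc ?n) (?s (Suc ?n) g)) = ?F g"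
    by (intro hom_cochain_cong) (auto simp: face_def)
  have cons0: "?F (face 0 (case_nat 0 g)) = ?F g"
    by (intro hom_cochain_cong) (auto simp: face_def)
  have cons: "?F (face (Suc j) (case_nat 0 g)) = ?F (case_nat 0 (restrict (face j g) {..<?n}))" for j
    by (intro hom_cochain_cong) (auto simp: face_def split: nat.split)
  have 1: "(\<Sum>j\<le>Suc ?n. alt j (?F (face j (?s (Suc ?n) g))))
      = (\<Sum>j\<le>?n. alt j (?F (?s ?n (restrict (face j g) {..<?n})))) + alt (Suc ?n) (?F g)"
    unfolding sum.atMost_Suc[of _ ?n] snoc_last
    by (rule arg_cong2[where f = "(+)"], rule sum.cong) (simp_all only: snoc atMost_iff)
  \<comment> \<open>Prepending 0 moves each omitted position of \<open>g\<close> up by one, hence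
    the minus sign. The sign \<open>alt n\<close> inside \<open>tau\<close> also changes by one
    degree between the two sides, and the two changes compensate.\<close>
  have 2: "(\<Sum>j\<le>Suc ?n. alt j (?F (face j (case_nat 0 g))))
      = ?F g - (\<Sum>j\<le>?n. alt j (?F (case_nat 0 (restrict (face j g) {..<?n}))))"
    unfolding sum.atMost_Suc_shift[of _ ?n] cons0 cons by (simp add: sum_negf)
  show ?thesis
    unfolding cech_diff_face tau_hom_cochain[OF assms] hom_cochain_gp_diff[OF assms] 1 2
    by (simp only: alt_diff alt_sum sum_subtractf alt_commute[of "Suc m"])
      (simp only: alt_Suc alt_minus sum_negf, simp, rule sum.cong[OF refl alt_commute])
qed

section \<open>Local continuity and continuity on boxes\<close>

text \<open>The codomain is an arbitrary topological space, unlike in \<open>loc_cochain\<close>: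
  pairs of maps are then covered, and sums and the action reduce to composition with a continuous
  map of two variables.\<close>

definition loc_continuous :: "nat \<Rightarrow> ((nat \<Rightarrow> 'g::topological_group_add) \<Rightarrow> 't::topological_space) \<Rightarrow> bool"
  where "loc_continuous n f \<longleftrightarrow> (\<exists>W. openin (pow_top n) W \<and> (\<lambda>i\<in>{..<n}. 0) \<in> W \<and>
    continuous_map (subtopology (pow_top n) W) euclidean f)"

lemma topspace_pow_top [simp]: "topspace (pow_top n) = tuples n"
  by (simp add: pow_top_def tuples_def)

lemma loc_cochain_iff: "loc_cochain n f \<longleftrightarrow> loc_continuous n f"
proof
  assume "loc_cochain n f"
  then show "loc_continuous n f"
    unfolding loc_cochain_def loc_continuous_def continuous_on_nbhd_def identity_nbhd_def
    by (meson continuous_map_from_subtopology_mono)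
next
  assume "loc_continuous n f"
  then show "loc_cochain n f"
    unfolding loc_cochain_def loc_continuous_def continuous_on_nbhd_def identity_nbhd_def
    by (metis openin_subset order_refl topspace_pow_top)
qed

lemma loc_continuous_global:
  "continuous_map (pow_top n) euclidean f \<Longrightarrow> loc_continuous n f"
  unfolding loc_continuous_def
  by (intro exI[of _ "tuples n"])
    (use openin_topspace[of "pow_top n"] in \<open>auto intro: continuous_map_from_subtopology\<close>)

lemma loc_continuous_compose_right:
  assumes f: "loc_continuous n f"
    and M: "continuous_map (pow_top m) (pow_top n) M" "M (\<lambda>i\<in>{..<m}. 0) = (\<lambda>i\<in>{..<n}. 0)"
  shows "loc_continuous m (\<lambda>g. f (M g))"
proof -
  obtain W where W: "openin (pow_top n) W" "(\<lambda>i\<in>{..<n}. 0) \<in> W"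
    "continuous_map (subtopology (pow_top n) W) euclidean f"
    using f unfolding loc_continuous_def by blast
  let ?W = "{g \<in> tuples m. M g \<in> W}"
  have "openin (pow_top m) ?W"
    using openin_continuous_map_preimage[OF M(1) W(1)] by simp
  moreover have "continuous_map (subtopology (pow_top m) ?W) (subtopology (pow_top n) W) M"
    by (intro continuous_map_into_subtopology continuous_map_from_subtopology M(1)) auto
  then have "continuous_map (subtopology (pow_top m) ?W) euclidean (\<lambda>g. f (M g))"
    using continuous_map_compose[OF _ W(3)] by (simp add: comp_def)
  ultimately show ?thesis
    unfolding loc_continuous_def using M(2) W(2) by (intro exI[of _ ?W]) auto
qed

text \<open>Made for local sections and local retractions of the bundle, which are continuous only
  on an open set: the neighbourhood of the identity is shrunk to the preimage of S.\<close>

lemma loc_continuous_compose_left: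
  assumes f: "loc_continuous n f" and u: "continuous_on S u" "open S" "f (\<lambda>i\<in>{..<n}. 0) \<in> S"
  shows "loc_continuous n (\<lambda>g. u (f g))"
proof -
  obtain W where W: "openin (pow_top n) W" "(\<lambda>i\<in>{..<n}. 0) \<in> W"
    "continuous_map (subtopology (pow_top n) W) euclidean f"
    using f unfolding loc_continuous_def by blast
  let ?W = "{g \<in> topspace (subtopology (pow_top n) W). f g \<in> S}"
  have "openin (subtopology (pow_top n) W) ?W"
    using u(2) by (intro openin_continuous_map_preimage[OF W(3)]) simp
  then have "openin (pow_top n) ?W"
    using W(1) openin_trans_full by blast
  moreover have "continuous_map (subtopology (pow_top n) ?W) (top_of_set S) f"
    by (intro continuous_map_into_subtopology continuous_map_from_subtopology_mono[OF W(3)]) auto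
  then have "continuous_map (subtopology (pow_top n) ?W) euclidean (\<lambda>g. u (f g))"
    using continuous_map_compose[of _ _ f euclidean u] u(1) by (simp add: comp_def)
  ultimately show ?thesis
    unfolding loc_continuous_def using W(2) u(3) by (intro exI[of _ ?W]) auto
qed

lemma loc_continuous_Pair:
  assumes "loc_continuous n f" "loc_continuous n f'"
  shows "loc_continuous n (\<lambda>g. (f g, f' g))"
proof -
  obtain W W' where "openin (pow_top n) W" "(\<lambda>i\<in>{..<n}. 0) \<in> W"
    "continuous_map (subtopology (pow_top n) W) euclidean f"
    "openin (pow_top n) W'" "(\<lambda>i\<in>{..<n}. 0) \<in> W'"
    "continuous_map (subtopology (pow_top n) W') euclidean f'"
    using assms unfolding loc_continuous_def by blast
  moreover from this have "continuous_map (subtopology (pow_top n) (W \<inter> W')) euclidean f"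
    "continuous_map (subtopology (pow_top n) (W \<inter> W')) euclidean f'"
    by (auto elim: continuous_map_from_subtopology_mono)
  ultimately show ?thesis
    unfolding loc_continuous_def prod_topology_euclidean[symmetric]
    by (intro exI[of _ "W \<inter> W'"] conjI continuous_map_pairedI openin_Int) auto
qed

lemma loc_continuous_compose2:
  assumes "continuous_on UNIV (\<lambda>(a, b). u a b)" "loc_continuous n f" "loc_continuous n f'"
  shows "loc_continuous n (\<lambda>g. u (f g) (f' g))"
  using loc_continuous_compose_left[OF loc_continuous_Pair[OF assms(2,3)] assms(1)] by simp

lemma loc_continuous_add:
  fixes f f' :: "_ \<Rightarrow> 'a::topological_monoid_add"
  shows "loc_continuous n f \<Longrightarrow> loc_continuous n f' \<Longrightarrow> loc_continuous n (\<lambda>g. f g + f' g)"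
  by (rule loc_continuous_compose2) (auto simp: case_prod_unfold intro!: continuous_intros)

lemma loc_continuous_minus:
  fixes f :: "_ \<Rightarrow> 'a::topological_group_add"
  shows "loc_continuous n f \<Longrightarrow> loc_continuous n (\<lambda>g. - f g)"
  by (rule loc_continuous_compose_left[of _ _ UNIV]) (auto intro!: continuous_intros)

lemma loc_continuous_diff:
  fixes f f' :: "_ \<Rightarrow> 'a::topological_group_add"
  shows "loc_continuous n f \<Longrightarrow> loc_continuous n f' \<Longrightarrow> loc_continuous n (\<lambda>g. f g - f' g)"
  unfolding diff_conv_add_uminus by (intro loc_continuous_add loc_continuous_minus)

lemma loc_continuous_alt:
  fixes f :: "_ \<Rightarrow> 'a::topological_ab_group_add"
  shows "loc_continuous n f \<Longrightarrow> loc_continuous n (\<lambda>g. alt j (f g))"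
  by (cases "even j") (simp_all add: alt_def loc_continuous_minus)

lemma loc_continuous_const: "loc_continuous n (\<lambda>_. c)"
  by (simp add: loc_continuous_global)

lemma loc_continuous_sum:
  fixes f :: "_ \<Rightarrow> _ \<Rightarrow> 'a::topological_ab_group_add"
  shows "(\<And>j. j \<in> J \<Longrightarrow> loc_continuous n (f j)) \<Longrightarrow> loc_continuous n (\<lambda>g. \<Sum>j\<in>J. f j g)"
  by (induction J rule: infinite_finite_induct) (auto intro: loc_continuous_const loc_continuous_add)

lemma continuous_map_pow_top:
  assumes "\<And>i. i < n \<Longrightarrow> continuous_map X euclidean (\<lambda>x. M x i)"
  shows "continuous_map X (pow_top n) (\<lambda>x. \<lambda>i\<in>{..<n}. M x i)"
  unfolding pow_top_def continuous_map_componentwise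
  using assms by auto

lemma continuous_map_component:
  "i < n \<Longrightarrow> continuous_map (pow_top n) euclidean (\<lambda>g. g i)"
  unfolding pow_top_def by (rule continuous_map_product_projection) simp

lemma continuous_map_add_group:
  fixes f f' :: "_ \<Rightarrow> 'a::topological_monoid_add"
  assumes "continuous_map X euclidean f" "continuous_map X euclidean f'"
  shows "continuous_map X euclidean (\<lambda>x. f x + f' x)"
  using assms by (simp add: continuous_map_atin tendsto_add)

lemma loc_cochain_gp_diff:
  assumes "top_module act" and f: "loc_cochain n f"
  shows "loc_cochain (Suc n) (gp_diff act n f)"
proof -
  have f: "loc_continuous n f"
    using f by (simp add: loc_cochain_iff)
  have shift: "loc_continuous (Suc n) (\<lambda>g. f (\<lambda>i\<in>{..<n}. g (Suc i)))"
    by (intro loc_continuous_compose_right[OF f] continuous_map_pow_top continuous_map_component) auto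
  have "loc_continuous (Suc n) (\<lambda>g. act (g 0) (f (\<lambda>i\<in>{..<n}. g (Suc i))))"
    by (rule loc_continuous_compose2[OF _ _ shift])
      (use assms(1) in \<open>auto simp: top_module_def intro!: loc_continuous_global continuous_map_component\<close>)
  moreover have "loc_continuous (Suc n) (\<lambda>g. f (\<lambda>i\<in>{..<n}.
      if i < j - 1 then g i else if i = j - 1 then g (j - 1) + g j else g (Suc i)))" if "j \<in> {1..n}" for j
  proof (rule loc_continuous_compose_right[OF f], rule continuous_map_pow_top, goal_cases)
    case (1 i)
    then show ?case
      using that by (cases "i < j - 1"; cases "i = j - 1")
        (auto intro!: continuous_map_component continuous_map_add_group)
  qed (use that in auto)
  moreover have "loc_continuous (Suc n) (\<lambda>g. f (\<lambda>i\<in>{..<n}. g i))"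
    by (intro loc_continuous_compose_right[OF f] continuous_map_pow_top continuous_map_component) auto
  ultimately show ?thesis
    unfolding loc_cochain_iff gp_diff_def
    by (intro loc_continuous_add loc_continuous_sum loc_continuous_alt) auto
qed

section \<open>Boxes with sides V^2 and symmetric neighbourhoods\<close>

definition box2 :: "nat \<Rightarrow> 'g::topological_group_add set \<Rightarrow> (nat \<Rightarrow> 'g) set"
  where "box2 n V = {..<n} \<rightarrow>\<^sub>E {v + w |v w. v \<in> V \<and> w \<in> V}"

definition continuous_on_box :: "nat \<Rightarrow> 'g::topological_group_add set \<Rightarrow>
    ((nat \<Rightarrow> 'g) \<Rightarrow> 'a::topological_space) \<Rightarrow> bool"
  where "continuous_on_box n V f \<longleftrightarrow> continuous_map (subtopology (pow_top n) (box2 n V)) euclidean f"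

text \<open>Symmetry is demanded independently of the degree, so that one V can serve cochains of
  neighbouring degrees at the same time.\<close>

definition sym_nbhd :: "'g::topological_group_add set \<Rightarrow> bool"
  where "sym_nbhd V \<longleftrightarrow> open V \<and> 0 \<in> V \<and> uminus ` V = V"

lemma sym_nbhd_Int: "sym_nbhd V \<Longrightarrow> sym_nbhd V' \<Longrightarrow> sym_nbhd (V \<inter> V')"
  by (simp add: sym_nbhd_def open_Int image_Int)

lemma continuous_on_box_mono:
  "continuous_on_box n V f \<Longrightarrow> V' \<subseteq> V \<Longrightarrow> continuous_on_box n V' f"
  unfolding continuous_on_box_def
  by (erule continuous_map_from_subtopology_mono) (unfold box2_def, rule PiE_mono, blast)

lemma mem_translates: "x \<in> translates V g \<longleftrightarrow> - g + x \<in> V"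
proof
  assume "x \<in> translates V g"
  then show "- g + x \<in> V"
    by (auto simp: translates_def)
next
  assume "- g + x \<in> V"
  then have "g + (- g + x) \<in> translates V g"
    unfolding translates_def by (rule imageI)
  then show "x \<in> translates V g"
    by simp
qed

lemma open_translates:
  fixes V :: "'g::topological_group_add set"
  assumes "open V"
  shows "open (translates V g)"
proof -
  have "translates V g = (\<lambda>x. - g + x) -` V"
    by (auto simp: mem_translates)
  moreover have "open ((\<lambda>x. - g + x) -` V)"
    by (intro open_vimage assms continuous_intros)
  ultimately show ?thesis by simp
qed

lemma openin_box2:
  assumes "open V"
  shows "openin (pow_top n) (box2 n V)"
proof -
  have "{v + w |v w. v \<in> V \<and> w \<in> V} = (\<Union>v\<in>V. translates V v)"
    by (auto simp: translates_def)
  then show ?thesis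
    using assms unfolding box2_def pow_top_def
    by (auto simp: openin_PiE_gen open_translates)
qed

lemma sym_nbhd_tau_nbhds:
  assumes V: "sym_nbhd V" and f: "continuous_on_box n V f"
  shows "tau_nbhds n f (box2 n V) V"
proof -
  have V0: "open V" "0 \<in> V" "uminus ` V = V"
    using V by (auto simp: sym_nbhd_def)
  have "(\<lambda>i\<in>{..<n}. 0) \<in> box2 n V"
    using V0(2) by (auto simp: box2_def intro!: exI[of _ 0])
  moreover note openin_box2[OF V0(1), of n]
  moreover from this have "box2 n V \<subseteq> tuples n"
    using openin_subset by fastforce
  ultimately show ?thesis
    using V0 f unfolding tau_nbhds_def continuous_on_nbhd_def identity_nbhd_def continuous_on_box_def
    unfolding box2_def[symmetric] by (intro conjI exI[of _ "box2 n V"]) auto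
qed

text \<open>A basic open box inside W has finitely many sides; M is their intersection (all of G if
  n = 0). Continuity of the group law at (0, 0) gives P + Q inside M, and intersecting P and Q with
  their inverses makes V symmetric.\<close>

lemma ex_sym_nbhd:
  assumes "loc_cochain n f"
  obtains V where "sym_nbhd V" "continuous_on_box n V f"
proof -
  obtain W where W: "openin (pow_top n) W" "(\<lambda>i\<in>{..<n}. 0) \<in> W"
    "continuous_map (subtopology (pow_top n) W) euclidean f"
    using assms unfolding loc_cochain_iff loc_continuous_def by blast
  obtain N where N: "\<And>i. i < n \<Longrightarrow> open (N i)" "(\<lambda>i\<in>{..<n}. 0) \<in> Pi\<^sub>E {..<n} N" "Pi\<^sub>E {..<n} N \<subseteq> W"
    using bspec[OF iffD1[OF openin_product_topology_alt W(1)[unfolded pow_top_def]] W(2)] by auto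
  define M where "M = (\<Inter>i\<in>{..<n}. N i)"
  have M: "open M" "0 \<in> M"
    using N(1,2) by (auto simp: M_def)
  have "open ((\<lambda>(v, w). v + w :: 'a) -` M)"
    by (rule open_vimage[OF M(1)]) (auto simp: case_prod_unfold intro!: continuous_intros)
  moreover have "(0, 0) \<in> (\<lambda>(v, w). v + w) -` M"
    using M by simp
  ultimately obtain P Q where PQ: "open P" "open Q" "0 \<in> P" "0 \<in> Q" "P \<times> Q \<subseteq> (\<lambda>(v, w). v + w) -` M"
    by (auto elim!: open_prod_elim)
  define V where "V = (P \<inter> Q) \<inter> uminus -` (P \<inter> Q)"
  have "open (uminus -` (P \<inter> Q))"
    by (intro open_vimage open_Int PQ continuous_intros)
  moreover have "uminus ` V = V"
    by (auto simp: V_def image_iff intro!: bexI[of _ "- _"])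
  ultimately have V: "sym_nbhd V"
    using PQ by (auto simp: sym_nbhd_def V_def)
  have "{v + w |v w. v \<in> V \<and> w \<in> V} \<subseteq> M"
    using PQ(5) by (auto simp: V_def)
  then have "box2 n V \<subseteq> Pi\<^sub>E {..<n} N"
    unfolding box2_def by (intro PiE_mono) (auto simp: M_def)
  then have "continuous_on_box n V f"
    unfolding continuous_on_box_def
    by (rule continuous_map_from_subtopology_mono[OF W(3) order_trans[OF _ N(3)]])
  with that[OF V] show ?thesis .
qed

section \<open>The comparison map on cochains\<close>

lemma open_cover_translates:
  assumes "open V" "0 \<in> V"
  shows "open_cover (translates V)"
proof -
  have "x \<in> translates V x" for x
    using assms(2) by (simp add: mem_translates)
  then show ?thesis
    using assms(1) unfolding open_cover_def by (auto simp: open_translates)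
qed

lemma mem_cech_inter_translates:
  "x \<in> cech_inter (translates V) k g \<longleftrightarrow> (\<forall>i\<le>k. - g i + x \<in> V)"
  by (auto simp: cech_inter_def mem_translates)

lemma continuous_on_act:
  assumes "top_module act"
  shows "continuous_on UNIV (act g)"
proof -
  have "continuous_on UNIV (\<lambda>a. (\<lambda>(g, a). act g a) (g, a))"
    by (rule continuous_on_compose2[of UNIV])
      (use assms in \<open>auto simp: top_module_def intro!: continuous_intros\<close>)
  then show ?thesis by simp
qed

lemma continuous_on_into_pow_top:
  assumes "continuous_map (subtopology (pow_top n) U) euclidean f"
    and "\<And>i. i < n \<Longrightarrow> continuous_on I (\<lambda>x. M x i)"
    and "\<And>x. x \<in> I \<Longrightarrow> (\<lambda>i\<in>{..<n}. M x i) \<in> U"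
  shows "continuous_on I (\<lambda>x. f (\<lambda>i\<in>{..<n}. M x i))"
proof -
  have "continuous_map (top_of_set I) (pow_top n) (\<lambda>x. \<lambda>i\<in>{..<n}. M x i)"
    by (rule continuous_map_pow_top) (simp add: assms(2))
  then have "continuous_map (top_of_set I) (subtopology (pow_top n) U) (\<lambda>x. \<lambda>i\<in>{..<n}. M x i)"
    by (rule continuous_map_into_subtopology) (auto simp: assms(3))
  from continuous_map_compose[OF this assms(1)] show ?thesis
    by (simp add: comp_def)
qed

lemma box2I: "(\<And>i. i < n \<Longrightarrow> \<exists>v\<in>V. \<exists>w\<in>V. M i = v + w) \<Longrightarrow> (\<lambda>i\<in>{..<n}. M i) \<in> box2 n V"
  by (force simp: box2_def)

text \<open>For x in the intersection, - g i + g (Suc i) equals (- g i + x) + - (- g (Suc i) + x),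
  which is in V^2 when V is symmetric; the last argument lies in V, hence in V^2 as 0 is in V. The
  map f need not be a cocycle, so lifts and primitives are covered too.\<close>

lemma cech_cochain_tau_of_box:
  assumes act: "top_module act"
    and f: "continuous_map (subtopology (pow_top (Suc m)) U) euclidean f" "box2 (Suc m) V \<subseteq> U"
    and V: "0 \<in> V" "m > 0 \<Longrightarrow> uminus ` V = V"
  shows "cech_cochain (translates V) m (tau act (Suc m) f)"
  unfolding cech_cochain_def
proof
  fix g :: "nat \<Rightarrow> 'a"
  let ?I = "cech_inter (translates V) m g"
  have "continuous_on ?I (\<lambda>x. f (\<lambda>i\<in>{..<Suc m}. if Suc i < Suc m then - g i + g (Suc i) else - g i + x))"
  proof (rule continuous_on_into_pow_top[OF f(1)], goal_cases)
    case (1 i)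
    then show ?case by (cases "i < m") (auto intro!: continuous_intros)
  next
    case (2 x)
    have *: "- g i + x \<in> V" if "i \<le> m" for i
      using 2 that by (simp add: mem_cech_inter_translates)
    show ?case
    proof (rule subsetD[OF f(2)], rule box2I)
      fix i assume "i < Suc m"
      show "\<exists>v\<in>V. \<exists>w\<in>V. (if Suc i < Suc m then - g i + g (Suc i) else - g i + x) = v + w"
      proof (cases "i < m")
        case True
        then have "- (- g (Suc i) + x) \<in> V"
          using V(2) *[of "Suc i"] by fastforce
        moreover have "- g i + g (Suc i) = (- g i + x) + - (- g (Suc i) + x)"
          by (simp add: minus_add add.assoc)
        ultimately show ?thesis
          using True *[of i] by (metis Suc_less_eq less_imp_le)
      next
        case False
        then show ?thesis
          using V(1) * \<open>i < Suc m\<close> by (intro bexI[of _ "- g i + x"] bexI[of _ 0]) auto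
      qed
    qed
  qed
  then have "continuous_on ?I (\<lambda>x. act (g 0)
      (f (\<lambda>i\<in>{..<Suc m}. if Suc i < Suc m then - g i + g (Suc i) else - g i + x)))"
    by (rule continuous_on_compose2[OF continuous_on_act[OF act, of "g 0"]]) auto
  then show "continuous_on ?I (tau act (Suc m) f g)"
    unfolding tau_def[abs_def] by (intro continuous_on_diff continuous_on_const)
qed

lemma cech_cochain_tau:
  assumes "top_module act" "sym_nbhd V" "continuous_on_box (Suc m) V f"
  shows "cech_cochain (translates V) m (tau act (Suc m) f)"
  using assms by (intro cech_cochain_tau_of_box[of _ _ "box2 (Suc m) V"]) (auto simp: sym_nbhd_def continuous_on_box_def)

text \<open>Without symmetry of \<open>V\<close> the point \<open>(c, y)\<close> with \<open>c = - g 0 + g 1\<close> may leave \<open>U\<close>. The cocycle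
  identity at \<open>(c, y\<^sub>0, - y\<^sub>0 + y)\<close> expresses \<open>f (c, y)\<close>, for \<open>y\<close> close to \<open>y\<^sub>0\<close>, by values of \<open>f\<close> on \<open>U\<close>.\<close>
lemma cech_cochain_tau_2:
  assumes act: "top_module act"
    and f: "continuous_map (subtopology (pow_top 2) U) euclidean f" "box2 2 V \<subseteq> U"
    and coc: "\<And>g. g \<in> tuples (Suc 2) \<Longrightarrow> gp_diff act 2 f g = 0"
    and V: "open V" "0 \<in> V"
  shows "cech_cochain (translates V) 1 (tau act 2 f)"
  unfolding cech_cochain_def
proof
  fix g :: "nat \<Rightarrow> 'a"
  let ?I = "cech_inter (translates V) 1 g"
  define P where "P a b = (\<lambda>i\<in>{..<2::nat}. if i = 0 then a else b)" for a b :: 'a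
  define c where "c = - g 0 + g 1"
  have P_eq: "(\<lambda>i\<in>{..<2::nat}. M i) = P (M 0) (M 1)" for M
    by (auto simp: P_def fun_eq_iff less_2_cases_iff)
  have cocycle: "f (P a (b + d)) = f (P a b) + f (P (a + b) d) - act a (f (P b d))" for a b d
  proof -
    define q where "q = (\<lambda>i\<in>{..<Suc 2}. if i = 0 then a else if i = 1 then b else d)"
    have "gp_diff act 2 f q = act a (f (P b d)) - f (P (a + b) d) + f (P a (b + d)) - f (P a b)"
    proof -
      have "{1..2::nat} = {1, 2}"
        by auto
      then show ?thesis
        unfolding gp_diff_def P_eq by (simp add: q_def alt_def)
    qed
    moreover have "gp_diff act 2 f q = 0"
      by (rule coc) (simp add: q_def)
    ultimately show ?thesis
      by (simp add: algebra_simps)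
  qed
  have cont: "continuous_on J (\<lambda>x. f (P a (u x)))"
    if "a \<in> V" "continuous_on J u" "\<And>x. x \<in> J \<Longrightarrow> u x \<in> V" for J a u
    unfolding P_def
  proof (rule continuous_on_into_pow_top[OF f(1)], goal_cases)
    case (1 i)
    then show ?case using that by (cases "i = 0") auto
  next
    case (2 x)
    have "\<exists>v\<in>V. \<exists>w\<in>V. (if i = 0 then a else u x) = v + w" for i :: nat
      using that 2 V(2) by (intro bexI[of _ "if i = 0 then a else u x"] bexI[of _ 0]) auto
    then show ?case
      by (intro subsetD[OF f(2)] box2I)
  qed
  have open_I: "open ?I"
    unfolding cech_inter_def by (intro open_INT) (auto simp: open_translates V)
  have "continuous_on (\<Union>x0\<in>?I. ?I \<inter> translates V x0) (\<lambda>x. f (P c (- g 1 + x)))"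
  proof (rule continuous_on_open_UN)
    fix x0 assume x0: "x0 \<in> ?I"
    let ?J = "?I \<inter> translates V x0"
    show "open ?J"
      by (intro open_Int open_I open_translates V)
    have "- g 0 + x0 \<in> V" "- g 1 + x0 \<in> V"
      using x0 by (auto simp: mem_cech_inter_translates)
    then have "continuous_on ?J (\<lambda>x. f (P (- g 0 + x0) (- x0 + x)))"
      "continuous_on ?J (\<lambda>x. f (P (- g 1 + x0) (- x0 + x)))"
      by (auto intro!: cont continuous_intros simp: mem_translates)
    \<comment> \<open>In \<open>cocycle\<close> take a = c, b = - g 1 + x0, d = - x0 + x, so that a
      + b = - g 0 + x0 and b + d = - g 1 + x. The point (c, - g 1 + x0) may lie outside U, but the
      value of f there is a constant in x.\<close>
    then have "continuous_on ?J (\<lambda>x. f (P c (- g 1 + x0)) + f (P (- g 0 + x0) (- x0 + x))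
        - act c (f (P (- g 1 + x0) (- x0 + x))))"
      by (intro continuous_intros continuous_on_compose2[OF continuous_on_act[OF act, of c]]) auto
    then show "continuous_on ?J (\<lambda>x. f (P c (- g 1 + x)))"
    proof (rule continuous_on_eq)
      fix x
      show "f (P c (- g 1 + x0)) + f (P (- g 0 + x0) (- x0 + x))
          - act c (f (P (- g 1 + x0) (- x0 + x))) = f (P c (- g 1 + x))"
        using cocycle[of c "- g 1 + x0" "- x0 + x"] by (simp add: c_def add.assoc)
    qed
  qed
  moreover have "(\<Union>x0\<in>?I. ?I \<inter> translates V x0) = ?I"
    using V(2) by (auto simp: mem_translates)
  ultimately have "continuous_on ?I (\<lambda>x. f (P c (- g 1 + x)))"
    by simp
  then have "continuous_on ?I (\<lambda>x. act (g 0) (f (P c (- g 1 + x))))"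
    by (rule continuous_on_compose2[OF continuous_on_act[OF act, of "g 0"]]) auto
  then show "continuous_on ?I (tau act 2 f g)"
    unfolding tau_def[abs_def] P_eq by (auto simp: c_def intro!: continuous_on_diff)
qed

lemma cech_cocycle_tau:
  assumes act: "top_module act" and f: "loc_cocycle act (Suc m) f" and V: "tau_nbhds (Suc m) f U V"
  shows "open_cover (translates V)" "cech_cocycle (translates V) m (tau act (Suc m) f)"
proof -
  have V': "continuous_map (subtopology (pow_top (Suc m)) U) euclidean f" "open V" "0 \<in> V"
    "box2 (Suc m) V \<subseteq> U" "3 \<le> Suc m \<Longrightarrow> uminus ` V = V"
    using V by (auto simp: tau_nbhds_def continuous_on_nbhd_def box2_def)
  have f': "gp_diff act (Suc m) f g = 0" if "g \<in> tuples (Suc (Suc m))" for g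
    using f that by (simp add: loc_cocycle_def)
  show "open_cover (translates V)"
    using V' by (simp add: open_cover_translates)
  have "cech_cochain (translates V) m (tau act (Suc m) f)"
  \<comment> \<open>This is the one degree where quotients g_j^{-1} g_{j+1} occur as arguments of
    the first summand although \<open>tau_nbhds\<close> does not provide symmetry.\<close>
  proof (cases "m = 1")
    case True
    then show ?thesis
      using cech_cochain_tau_2[OF act, of U f V] V' f' by (simp add: numeral_2_eq_2)
  next
    case False
    then show ?thesis
      using V' by (intro cech_cochain_tau_of_box[OF act, of m U]) auto
  qed
  moreover have "cech_diff m (tau act (Suc m) f) g x = 0" for g x
  proof -
    have "tau act (Suc (Suc m)) (gp_diff act (Suc m) f) g x = tau act (Suc (Suc m)) (\<lambda>_. 0) g x"
      by (rule tau_cong) (simp add: f')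
    also have "\<dots> = 0"
      using Modules.additive.zero[OF top_module_additive[OF act]] by (simp add: tau_def)
    finally show ?thesis
      by (simp add: tau_gp_diff[OF act])
  qed
  ultimately show "cech_cocycle (translates V) m (tau act (Suc m) f)"
    by (simp add: cech_cocycle_def)
qed

section \<open>Cohomology classes\<close>

lemma act_zero: "top_module act \<Longrightarrow> act g 0 = 0"
  by (rule Modules.additive.zero[OF top_module_additive])

lemma act_diff: "top_module act \<Longrightarrow> act g (a - b) = act g a - act g b"
  by (rule Modules.additive.diff[OF top_module_additive])

lemma gp_diff_diff:
  "top_module act \<Longrightarrow> gp_diff act n (\<lambda>g. f g - f' g) g = gp_diff act n f g - gp_diff act n f' g"
  by (simp add: gp_diff_def act_diff alt_diff sum_subtractf)

lemma gp_diff_add: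
  "top_module act \<Longrightarrow> gp_diff act n (\<lambda>g. f g + f' g) g = gp_diff act n f g + gp_diff act n f' g"
  using gp_diff_diff[of act n "\<lambda>g. f g + f' g" f' g] by simp

lemma tau_diff:
  "top_module act \<Longrightarrow> tau act n (\<lambda>g. f g - f' g) g x = tau act n f g x - tau act n f' g x"
  by (simp add: tau_def act_diff alt_diff)

lemma cech_diff_diff:
  "cech_diff k (\<lambda>g x. c g x - c' g x) g x = cech_diff k c g x - cech_diff k c' g x"
  by (simp add: cech_diff_def alt_diff sum_subtractf)

lemma loc_cochain_diff:
  "loc_cochain n f \<Longrightarrow> loc_cochain n f' \<Longrightarrow> loc_cochain n (\<lambda>g. f g - f' g)"
  unfolding loc_cochain_iff by (rule loc_continuous_diff)

lemma loc_cochain_add: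
  "loc_cochain n f \<Longrightarrow> loc_cochain n f' \<Longrightarrow> loc_cochain n (\<lambda>g. f g + f' g)"
  unfolding loc_cochain_iff by (rule loc_continuous_add)

text \<open>Closure under differences gives both symmetry and transitivity of being cohomologous,
  the latter through f'' - f = (f'' - f') - (f - f').\<close>

lemma loc_coboundary_diff:
  assumes act: "top_module act" and "loc_coboundary act n f" "loc_coboundary act n f'"
  shows "loc_coboundary act n (\<lambda>g. f g - f' g)"
proof (cases n)
  case 0
  then show ?thesis
    using assms by (simp add: loc_coboundary_def)
next
  case (Suc m)
  then obtain h h' where "loc_cochain m h" "loc_cochain m h'"
    "\<And>g. g \<in> tuples n \<Longrightarrow> f g = gp_diff act m h g" "\<And>g. g \<in> tuples n \<Longrightarrow> f' g = gp_diff act m h' g"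
    using assms by (auto simp: loc_coboundary_def)
  then show ?thesis
    unfolding loc_coboundary_def Suc
    by (auto simp: gp_diff_diff[OF act] Suc intro!: exI[of _ "\<lambda>g. h g - h' g"] loc_cochain_diff)
qed

lemma loc_coboundary_zero:
  assumes "top_module act"
  shows "loc_coboundary act n (\<lambda>_. 0)"
  by (auto simp: loc_coboundary_def gp_diff_def act_zero[OF assms] loc_cochain_iff
      split: nat.split intro!: exI[of _ "\<lambda>_. 0"] loc_continuous_const)

lemma equiv_loc_cohomologous:
  assumes act: "top_module act"
  shows "equiv {f. loc_cocycle act n f} (loc_cohomologous act n)"
proof (rule equivI)
  show "loc_cohomologous act n \<subseteq> {f. loc_cocycle act n f} \<times> {f. loc_cocycle act n f}"
    by (auto simp: loc_cohomologous_def)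
  show "refl_on {f. loc_cocycle act n f} (loc_cohomologous act n)"
    by (auto simp: refl_on_def loc_cohomologous_def loc_coboundary_zero[OF act])
  show "sym (loc_cohomologous act n)"
  proof (rule symI)
    fix f f' assume "(f, f') \<in> loc_cohomologous act n"
    then show "(f', f) \<in> loc_cohomologous act n"
      using loc_coboundary_diff[OF act loc_coboundary_zero[OF act], of n "\<lambda>g. f' g - f g"]
      by (simp add: loc_cohomologous_def)
  qed
  then have sym: "(f', f) \<in> loc_cohomologous act n" if "(f, f') \<in> loc_cohomologous act n" for f f'
    using that by (rule symD)
  show "trans (loc_cohomologous act n)"
  proof (rule transI)
    fix f f' f'' assume "(f, f') \<in> loc_cohomologous act n" "(f', f'') \<in> loc_cohomologous act n"
    then show "(f, f'') \<in> loc_cohomologous act n"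
      using sym[of f f'] loc_coboundary_diff[OF act, of n "\<lambda>g. f'' g - f' g" "\<lambda>g. f g - f' g"]
      by (simp add: loc_cohomologous_def)
  qed
qed

lemma loc_class_self: "top_module act \<Longrightarrow> loc_cocycle act n f \<Longrightarrow> f \<in> loc_class act n f"
  unfolding loc_class_def by (rule equiv_class_self[OF equiv_loc_cohomologous]) auto

lemma loc_cohomologyE:
  assumes "\<xi> \<in> loc_cohomology act n"
  obtains f where "loc_cocycle act n f" "\<xi> = loc_class act n f"
  using assms unfolding loc_cohomology_def loc_class_def by (auto elim: quotientE)

lemma loc_class_in_cohomology: "loc_cocycle act n f \<Longrightarrow> loc_class act n f \<in> loc_cohomology act n"
  unfolding loc_cohomology_def loc_class_def by (rule quotientI) simp

section \<open>Cech classes and shrinking of covers\<close>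

lemma cech_inter_mono: "(\<And>j. W j \<subseteq> U j) \<Longrightarrow> cech_inter W k g \<subseteq> cech_inter U k g"
  unfolding cech_inter_def by blast

lemma cech_cochain_mono: "cech_cochain U k c \<Longrightarrow> (\<And>j. W j \<subseteq> U j) \<Longrightarrow> cech_cochain W k c"
  unfolding cech_cochain_def by (blast intro: continuous_on_subset cech_inter_mono[THEN subsetD])

lemma cech_cocycle_mono: "cech_cocycle U k c \<Longrightarrow> (\<And>j. W j \<subseteq> U j) \<Longrightarrow> cech_cocycle W k c"
  unfolding cech_cocycle_def by (blast intro: cech_cochain_mono cech_inter_mono[THEN subsetD])

lemma cech_inter_face:
  "j \<le> Suc k \<Longrightarrow> x \<in> cech_inter U (Suc k) g \<Longrightarrow> x \<in> cech_inter U k (restrict (face j g) {..<Suc k})"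
  by (auto simp: cech_inter_def face_def)

lemma cech_diff_cong:
  assumes "\<And>h. h \<in> tuples (Suc k) \<Longrightarrow> x \<in> cech_inter U k h \<Longrightarrow> c h x = c' h x"
    and "x \<in> cech_inter U (Suc k) g"
  shows "cech_diff k c g x = cech_diff k c' g x"
  unfolding cech_diff_face
proof (rule sum.cong[OF refl])
  fix j assume "j \<in> {..Suc k}"
  then have "x \<in> cech_inter U k (restrict (face j g) {..<Suc k})"
    using cech_inter_face[OF _ assms(2)] by simp
  then show "alt j (c (restrict (face j g) {..<Suc k}) x) = alt j (c' (restrict (face j g) {..<Suc k}) x)"
    using assms(1)[OF restrict_in_tuples] by simp
qed

lemma cech_class_step:
  "cech_step k (U, c) (U', c') \<Longrightarrow> cech_class k U c = cech_class k U' c'"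
  unfolding cech_class_def
  by (blast intro: equivclp_trans equivclp_sym r_into_equivclp)

lemma cech_coboundary_zero:
  assumes "\<And>g x. g \<in> tuples (Suc k) \<Longrightarrow> x \<in> cech_inter U k g \<Longrightarrow> c g x = 0"
  shows "cech_coboundary U k c"
  using assms unfolding cech_coboundary_def
  by (auto simp: cech_cochain_def cech_diff_def split: nat.split intro!: exI[of _ "\<lambda>_ _. 0"])

text \<open>Refinement along the identity of indices yields c precomposed with a restriction, which
  agrees with c only on \<open>tuples\<close>; a second step with vanishing difference replaces it
  by c itself.\<close>

lemma cech_class_mono:
  assumes "open_cover U" "cech_cocycle U k c" "open_cover W" "\<And>j. W j \<subseteq> U j"
  shows "cech_class k U c = cech_class k W c"
proof -
  let ?c = "\<lambda>g. c (\<lambda>j\<in>{..<Suc k}. g j)"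
  have eq: "?c g = c g" if "g \<in> tuples (Suc k)" for g
    using restrict_tuples[OF that] by simp
  have W: "cech_cocycle W k c"
    using cech_cocycle_mono assms(2,4) by blast
  then have "cech_cocycle W k ?c"
    unfolding cech_cocycle_def cech_cochain_def
    by (auto simp: eq cong: cech_diff_cong)
  then have "cech_class k W ?c = cech_class k W c"
    using assms(3) W by (intro cech_class_step cech_step.cohomologous cech_coboundary_zero) (auto simp: eq)
  then show ?thesis
    using cech_class_step[OF cech_step.refine[OF assms]] by simp
qed

lemma translates_mono: "V \<subseteq> V' \<Longrightarrow> translates V g \<subseteq> translates V' g"
  by (auto simp: translates_def)

text \<open>If f' - f = d h, then \<open>tau\<close> f' - \<open>tau\<close> f = \<open>tau\<close>
  (d h) = d (\<open>tau\<close> h), and \<open>tau\<close> h is continuous once the cover is fine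
  enough for h.\<close>

lemma tau_class_unique:
  assumes act: "top_module act" and triv: "m > 0 \<or> (\<forall>g a. act g a = a)"
    and ff': "(f, f') \<in> loc_cohomologous act (Suc m)"
    and V: "tau_nbhds (Suc m) f U V" and V': "tau_nbhds (Suc m) f' U' V'"
  shows "cech_class m (translates V) (tau act (Suc m) f) = cech_class m (translates V') (tau act (Suc m) f')"
proof -
  obtain h where f: "loc_cocycle act (Suc m) f" "loc_cocycle act (Suc m) f'"
    and h: "loc_cochain m h" "\<And>g. g \<in> tuples (Suc m) \<Longrightarrow> f' g - f g = gp_diff act m h g"
    using ff' by (auto simp: loc_cohomologous_def loc_coboundary_def)
  obtain V1 where V1: "sym_nbhd V1" "continuous_on_box m V1 h"
    using ex_sym_nbhd[OF h(1)] by blast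
  \<comment> \<open>W may fail to be symmetric. Continuity of the three cochains is proved on the
    translates of V, V' and V1 separately and only restricted to those of W.\<close>
  define W where "W = V \<inter> V' \<inter> V1"
  have "open W" "0 \<in> W"
    using V V' V1 by (auto simp: W_def tau_nbhds_def sym_nbhd_def)
  then have W: "open_cover (translates W)"
    by (rule open_cover_translates)
  have mono: "translates W g \<subseteq> translates V g" "translates W g \<subseteq> translates V' g"
    "translates W g \<subseteq> translates V1 g" for g
    by (auto simp: W_def mem_translates)
  note tau_V = cech_cocycle_tau[OF act f(1) V]
  note tau_V' = cech_cocycle_tau[OF act f(2) V']
  have diff: "tau act (Suc m) f' g x - tau act (Suc m) f g x = tau act (Suc m) (gp_diff act m h) g x" for g x
    unfolding tau_diff[OF act, symmetric] by (rule tau_cong) (rule h(2))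
  have "cech_coboundary (translates W) m (\<lambda>g x. tau act (Suc m) f' g x - tau act (Suc m) f g x)"
  proof (cases m)
    \<comment> \<open>In Cech degree 0 cohomologous cocycles are equal, so d h itself has to vanish:
      it is g 0 . h - h, and the action is trivial by \<open>triv\<close>.\<close>
    case 0
    then have "gp_diff act m h g = 0" for g
      using triv by (simp add: gp_diff_def restrict_def)
    then show ?thesis
      unfolding diff by (intro cech_coboundary_zero) (simp add: tau_def act_zero[OF act])
  next
    case (Suc k)
    have "cech_cochain (translates W) k (tau act m h)"
      using cech_cochain_mono[OF cech_cochain_tau[OF act V1(1), of k h] mono(3)] V1(2) Suc by simp
    then show ?thesis
      unfolding cech_coboundary_def diff by (auto simp: Suc tau_gp_diff[OF act])
  qed
  then have "cech_class m (translates W) (tau act (Suc m) f) = cech_class m (translates W) (tau act (Suc m) f')"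
    by (intro cech_class_step cech_step.cohomologous W cech_cocycle_mono[OF tau_V(2) mono(1)]
        cech_cocycle_mono[OF tau_V'(2) mono(2)])
  then show ?thesis
    using cech_class_mono[OF tau_V W mono(1)] cech_class_mono[OF tau_V' W mono(2)] by simp
qed

lemma ex_tau_nbhds: "loc_cochain n f \<Longrightarrow> \<exists>U V. tau_nbhds n f U V"
  by (blast elim: ex_sym_nbhd intro: sym_nbhd_tau_nbhds)

text \<open>All members of the union defining \<open>tau_map\<close> coincide by
  \<open>tau_class_unique\<close>, and the one for f and V is among them.\<close>

lemma tau_map_class:
  assumes act: "top_module act" and triv: "m > 0 \<or> (\<forall>g a. act g a = a)"
    and f: "loc_cocycle act (Suc m) f" and V: "tau_nbhds (Suc m) f U V"
  shows "tau_map act (Suc m) (loc_class act (Suc m) f) = cech_class m (translates V) (tau act (Suc m) f)"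
    (is "_ = ?K")
proof -
  have K: "cech_class m (translates V') (tau act (Suc m) f') = ?K"
    if "f' \<in> loc_class act (Suc m) f" "tau_nbhds (Suc m) f' U' V'" for f' U' V'
    using tau_class_unique[OF act triv _ V that(2)] that(1) by (simp add: loc_class_def)
  show ?thesis
  proof
    show "tau_map act (Suc m) (loc_class act (Suc m) f) \<subseteq> ?K"
      unfolding tau_map_def using K by fastforce
    show "?K \<subseteq> tau_map act (Suc m) (loc_class act (Suc m) f)"
      unfolding tau_map_def using loc_class_self[OF act f] V by fastforce
  qed
qed

section \<open>Short exact sequences and connecting homomorphisms\<close>

lemma module_morphism_additive: "module_morphism actA actB \<phi> \<Longrightarrow> Modules.additive \<phi>"
  by (simp add: module_morphism_def Modules.additive_def)

lemma module_morphism_gp_diff: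
  assumes "module_morphism actA actB \<phi>"
  shows "\<phi> (gp_diff actA n f g) = gp_diff actB n (\<lambda>g. \<phi> (f g)) g"
proof -
  note additive = module_morphism_additive[OF assms]
  show ?thesis
    using assms by (simp add: gp_diff_def Modules.additive.add[OF additive] Modules.additive.diff[OF additive]
        Modules.additive.sum[OF additive] additive_alt[OF additive] module_morphism_def)
qed

lemma module_morphism_tau:
  assumes "module_morphism actA actB \<phi>"
  shows "\<phi> (tau actA n f g x) = tau actB n (\<lambda>g. \<phi> (f g)) g x"
proof -
  note additive = module_morphism_additive[OF assms]
  show ?thesis
    using assms by (simp add: tau_def Modules.additive.diff[OF additive]
        additive_alt[OF additive] module_morphism_def)
qed

lemma additive_cech_diff:
  assumes "Modules.additive \<phi>"
  shows "\<phi> (cech_diff k c g x) = cech_diff k (\<lambda>g x. \<phi> (c g x)) g x"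
  by (simp add: cech_diff_def Modules.additive.sum[OF assms] additive_alt[OF assms] del: sum.atMost_Suc)

locale short_exact_modules =
  fixes actA :: "'g::topological_group_add \<Rightarrow> 'a::topological_ab_group_add \<Rightarrow> 'a"
    and actB :: "'g \<Rightarrow> 'b::topological_ab_group_add \<Rightarrow> 'b"
    and actC :: "'g \<Rightarrow> 'c::topological_ab_group_add \<Rightarrow> 'c"
    and i :: "'a \<Rightarrow> 'b" and p :: "'b \<Rightarrow> 'c"
  assumes exact: "short_exact actA actB actC i p"
begin

lemma modA: "top_module actA" and modB: "top_module actB" and modC: "top_module actC"
  and mor_i: "module_morphism actA actB i" and mor_p: "module_morphism actB actC p"
  and inj_i: "inj i" and range_i: "range i = {b. p b = 0}" and surj_p: "surj p"
  using exact by (simp_all add: short_exact_def)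

lemma local_trivialization:
  obtains W \<phi> \<psi> where "open W" "c \<in> W" "homeomorphism (W \<times> UNIV) (p -` W) \<phi> \<psi>"
    "\<forall>w\<in>W. \<forall>a. p (\<phi> (w, a)) = w" "\<forall>w\<in>W. \<forall>a a'. \<phi> (w, a + a') = \<phi> (w, a) + i a'"
  using exact unfolding short_exact_def by meson

sublocale i: Modules.additive i
  using mor_i by (rule module_morphism_additive)

sublocale p: Modules.additive p
  using mor_p by (rule module_morphism_additive)

lemma continuous_on_p: "continuous_on UNIV p"
  using mor_p by (simp add: module_morphism_def)

lemma p_i [simp]: "p (i a) = 0"
  using range_i by auto

lemma i_continuous: "continuous_on UNIV i"
  using mor_i by (simp add: module_morphism_def)

text \<open>The fibre coordinate of a trivialization near 0 is a left inverse of i up to a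
  translation. Thus i is an embedding, and continuity of an A-valued map can be checked after
  applying i.\<close>

lemma local_retraction:
  obtains r S where "open S" "range i \<subseteq> S" "continuous_on S r" "\<forall>a. r (i a) = a"
proof -
  obtain W \<phi> \<psi> where W: "open W" "0 \<in> W" and hom: "homeomorphism (W \<times> UNIV) (p -` W) \<phi> \<psi>"
    and \<phi>: "\<forall>w\<in>W. \<forall>a. p (\<phi> (w, a)) = w" "\<forall>w\<in>W. \<forall>a a'. \<phi> (w, a + a') = \<phi> (w, a) + i a'"
    by (rule local_trivialization[of 0]) (rule that)
  \<comment> \<open>The trivialization need not send (0, 0) to 0. Since \<phi> (0, a) =
    \<open>?b\<close> + i a, shifting the argument by \<open>?b\<close> before applying \<psi> makes
    the fibre coordinate of i a equal to a.\<close>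
  let ?b = "\<phi> (0, 0)"
  define S where "S = (\<lambda>b. p (?b + b)) -` W"
  have pb: "p ?b = 0"
    using \<phi>(1) W(2) by blast
  have "continuous_on UNIV (\<lambda>b. p (?b + b))"
    by (intro continuous_on_compose2[OF continuous_on_p] continuous_intros) auto
  then have "open S"
    unfolding S_def using W(1) by (simp add: open_vimage)
  moreover have "range i \<subseteq> S"
    using W(2) by (auto simp: S_def p.add pb)
  moreover have "continuous_on S (\<lambda>b. snd (\<psi> (?b + b)))"
  proof (rule continuous_on_snd, rule continuous_on_compose2[of "p -` W" \<psi>])
    show "continuous_on S (\<lambda>b. ?b + b)"
      by (intro continuous_on_add continuous_on_const continuous_on_id)
  qed (use hom in \<open>auto simp: homeomorphism_def S_def\<close>)
  moreover have "snd (\<psi> (?b + i a)) = a" for a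
  proof -
    have "?b + i a = \<phi> (0, a)"
      using \<phi>(2) W(2) by (metis add_0)
    then show ?thesis
      using hom W(2) by (simp add: homeomorphism_def)
  qed
  ultimately show ?thesis
    using that by blast
qed

text \<open>Compose f with a section of p that is continuous near the value of f at the identity,
  namely c \<mapsto> \<phi> (c, 0), and that is an arbitrary choice of preimages elsewhere.\<close>

lemma lift_loc_cochain:
  assumes f: "loc_cochain n f"
  obtains ft where "loc_cochain n ft" "\<And>g. p (ft g) = f g"
proof -
  let ?e = "\<lambda>i\<in>{..<n}. 0"
  obtain W \<phi> \<psi> where W: "open W" "f ?e \<in> W" and hom: "homeomorphism (W \<times> UNIV) (p -` W) \<phi> \<psi>"
    and \<phi>: "\<forall>w\<in>W. \<forall>a. p (\<phi> (w, a)) = w" "\<forall>w\<in>W. \<forall>a a'. \<phi> (w, a + a') = \<phi> (w, a) + i a'"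
    by (rule local_trivialization[of "f ?e"]) (rule that)
  define s where "s c = (if c \<in> W then \<phi> (c, 0) else inv p c)" for c
  have "continuous_on W (\<lambda>c. \<phi> (c, 0))"
  proof (rule continuous_on_compose2[of "W \<times> UNIV" \<phi>])
    show "continuous_on W (\<lambda>c. (c, 0 :: 'a))"
      by (intro continuous_on_Pair continuous_on_const continuous_on_id)
  qed (use hom in \<open>auto simp: homeomorphism_def\<close>)
  then have "continuous_on W s"
    by (rule continuous_on_eq) (simp add: s_def)
  then have "loc_cochain n (\<lambda>g. s (f g))"
    using f W unfolding loc_cochain_iff by (blast intro: loc_continuous_compose_left)
  moreover have "p (s c) = c" for c
    using \<phi>(1) surj_p by (auto simp: s_def surj_f_inv_f)
  ultimately show ?thesis
    using that[of "\<lambda>g. s (f g)"] by simp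
qed

lemma kernel_loc_cochain:
  assumes b: "loc_cochain n b" "\<And>g. g \<in> tuples n \<Longrightarrow> p (b g) = 0"
  obtains a where "loc_cochain n a" "\<And>g. g \<in> tuples n \<Longrightarrow> i (a g) = b g"
proof -
  obtain r S where r: "open S" "range i \<subseteq> S" "continuous_on S r" "\<forall>a. r (i a) = a"
    by (rule local_retraction) (rule that)
  have range: "b g \<in> range i" if "g \<in> tuples n" for g
    using b(2)[OF that] range_i by simp
  have "b (\<lambda>i\<in>{..<n}. 0) \<in> S"
    by (rule subsetD[OF r(2) range]) simp
  then have "loc_cochain n (\<lambda>g. r (b g))"
    using b(1) r(1,3) unfolding loc_cochain_iff by (blast intro: loc_continuous_compose_left)
  moreover have "i (r (b g)) = b g" if "g \<in> tuples n" for g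
    using range[OF that] r(4) by auto
  ultimately show ?thesis
    using that[of "\<lambda>g. r (b g)"] by simp
qed

text \<open>p annihilates d ft because f is a cocycle, so d ft comes from some h; i sends d h to d
  (d ft) = 0, and i is injective.\<close>

lemma ex_connecting_cocycle:
  assumes f: "loc_cocycle actC n f" and ft: "loc_cochain n ft" "\<And>g. g \<in> tuples n \<Longrightarrow> p (ft g) = f g"
  obtains h where "loc_cocycle actA (Suc n) h" "\<And>g. g \<in> tuples (Suc n) \<Longrightarrow> i (h g) = gp_diff actB n ft g"
proof -
  have "p (gp_diff actB n ft g) = 0" if "g \<in> tuples (Suc n)" for g
  proof -
    have "p (gp_diff actB n ft g) = gp_diff actC n f g"
      unfolding module_morphism_gp_diff[OF mor_p] by (rule gp_diff_cong) (rule ft(2))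
    then show ?thesis
      using f that by (simp add: loc_cocycle_def)
  qed
  then obtain h where h: "loc_cochain (Suc n) h" "\<And>g. g \<in> tuples (Suc n) \<Longrightarrow> i (h g) = gp_diff actB n ft g"
    using kernel_loc_cochain[OF loc_cochain_gp_diff[OF modB ft(1)]] by blast
  have "gp_diff actA (Suc n) h g = 0" if "g \<in> tuples (Suc (Suc n))" for g
  proof -
    have "i (gp_diff actA (Suc n) h g) = gp_diff actB (Suc n) (gp_diff actB n ft) g"
      unfolding module_morphism_gp_diff[OF mor_i] by (rule gp_diff_cong) (rule h(2))
    also have "\<dots> = i 0"
      using gp_diff_gp_diff[OF modB that] by (simp add: i.zero)
    finally show ?thesis
      using inj_i by (simp add: inj_eq)
  qed
  then have "loc_cocycle actA (Suc n) h"
    using h(1) by (simp add: loc_cocycle_def)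
  from that[OF this h(2)] show ?thesis .
qed

text \<open>The set of all possible values is exactly one class: changing representative and lift
  changes h by a coboundary, and every cocycle cohomologous to h arises from another lift of
  f.\<close>

lemma gp_connecting_class:
  assumes f: "loc_cocycle actC (Suc m) f" and ft: "loc_cochain (Suc m) ft" "\<And>g. g \<in> tuples (Suc m) \<Longrightarrow> p (ft g) = f g"
    and h: "loc_cocycle actA (Suc (Suc m)) h" "\<And>g. g \<in> tuples (Suc (Suc m)) \<Longrightarrow> i (h g) = gp_diff actB (Suc m) ft g"
  shows "gp_connecting actA actB i p (Suc m) (loc_class actC (Suc m) f) = loc_class actA (Suc (Suc m)) h"
    (is "?L = ?R")
proof
  show "?L \<subseteq> ?R"
  proof
    fix h' assume "h' \<in> ?L"
    then obtain f' ft' where h': "loc_cocycle actA (Suc (Suc m)) h'"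
        "\<And>g. g \<in> tuples (Suc (Suc m)) \<Longrightarrow> i (h' g) = gp_diff actB (Suc m) ft' g"
      and f': "f' \<in> loc_class actC (Suc m) f"
      and ft': "loc_cochain (Suc m) ft'" "\<And>g. g \<in> tuples (Suc m) \<Longrightarrow> p (ft' g) = f' g"
      unfolding gp_connecting_def by blast
    obtain k where k: "loc_cochain m k" "\<And>g. g \<in> tuples (Suc m) \<Longrightarrow> f' g - f g = gp_diff actC m k g"
      using f' by (auto simp: loc_class_def loc_cohomologous_def loc_coboundary_def)
    obtain kt where kt: "loc_cochain m kt" "\<And>g. p (kt g) = k g"
      using lift_loc_cochain[OF k(1)] by blast
    \<comment> \<open>The lift kt of the primitive k corrects the change of representative, so that
      p annihilates the difference and it descends to an A-valued cochain e.\<close>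
    let ?b = "\<lambda>g. ft' g - ft g - gp_diff actB m kt g"
    have "loc_cochain (Suc m) ?b"
      by (intro loc_cochain_diff ft ft' loc_cochain_gp_diff[OF modB] kt)
    moreover have "p (?b g) = 0" if "g \<in> tuples (Suc m)" for g
      using that by (simp add: p.diff ft(2) ft'(2) k(2) module_morphism_gp_diff[OF mor_p] kt(2))
    ultimately obtain e where e: "loc_cochain (Suc m) e" "\<And>g. g \<in> tuples (Suc m) \<Longrightarrow> i (e g) = ?b g"
      using kernel_loc_cochain by blast
    have "h' g - h g = gp_diff actA (Suc m) e g" if g: "g \<in> tuples (Suc (Suc m))" for g
    proof -
      have "i (gp_diff actA (Suc m) e g) = gp_diff actB (Suc m) ?b g"
        unfolding module_morphism_gp_diff[OF mor_i] by (rule gp_diff_cong) (rule e(2))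
      also have "\<dots> = i (h' g - h g)"
        by (simp add: gp_diff_diff[OF modB] gp_diff_gp_diff[OF modB g] i.diff h(2) h'(2) g)
      finally show ?thesis
        using inj_i by (simp add: inj_eq)
    qed
    then show "h' \<in> ?R"
      using h(1) h'(1) e(1) by (auto simp: loc_class_def loc_cohomologous_def loc_coboundary_def)
  qed
  show "?R \<subseteq> ?L"
  proof
    fix h' assume "h' \<in> ?R"
    then obtain e where h': "loc_cocycle actA (Suc (Suc m)) h'"
      and e: "loc_cochain (Suc m) e" "\<And>g. g \<in> tuples (Suc (Suc m)) \<Longrightarrow> h' g - h g = gp_diff actA (Suc m) e g"
      by (auto simp: loc_class_def loc_cohomologous_def loc_coboundary_def)
    let ?ft = "\<lambda>g. ft g + i (e g)"
    have "loc_cochain (Suc m) (\<lambda>g. i (e g))"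
      using e(1) loc_continuous_compose_left[OF _ i_continuous] by (auto simp: loc_cochain_iff)
    then have "loc_cochain (Suc m) ?ft"
      by (rule loc_cochain_add[OF ft(1)])
    moreover have "p (?ft g) = f g" if "g \<in> tuples (Suc m)" for g
      using ft(2)[OF that] by (simp add: p.add)
    moreover have "i (h' g) = gp_diff actB (Suc m) ?ft g" if g: "g \<in> tuples (Suc (Suc m))" for g
    proof -
      have "i (h' g) = i (h g) + i (gp_diff actA (Suc m) e g)"
        unfolding e(2)[OF g, symmetric] i.add[symmetric] by simp
      then show ?thesis
        by (simp add: gp_diff_add[OF modB] h(2)[OF g] module_morphism_gp_diff[OF mor_i])
    qed
    ultimately show "h' \<in> ?L"
      unfolding gp_connecting_def using h' loc_class_self[OF modC f] by blast
  qed
qed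

text \<open>The cocycle, its lift and the resulting A-valued cocycle are made continuous over the
  same V, so that their images under \<open>tau\<close> live on one cover.\<close>

lemma connecting_data:
  assumes f: "loc_cocycle actC (Suc m) f"
  obtains ft h V where "sym_nbhd V" "continuous_on_box (Suc m) V f" "continuous_on_box (Suc m) V ft"
    "continuous_on_box (Suc (Suc m)) V h" "\<forall>g. p (ft g) = f g" "loc_cocycle actA (Suc (Suc m)) h"
    "\<forall>g\<in>tuples (Suc (Suc m)). i (h g) = gp_diff actB (Suc m) ft g"
    "gp_connecting actA actB i p (Suc m) (loc_class actC (Suc m) f) = loc_class actA (Suc (Suc m)) h"
proof -
  have f': "loc_cochain (Suc m) f"
    using f by (simp add: loc_cocycle_def)
  obtain ft where ft: "loc_cochain (Suc m) ft" "\<And>g. p (ft g) = f g"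
    using lift_loc_cochain[OF f'] by blast
  obtain h where h: "loc_cocycle actA (Suc (Suc m)) h"
    "\<And>g. g \<in> tuples (Suc (Suc m)) \<Longrightarrow> i (h g) = gp_diff actB (Suc m) ft g"
    using ex_connecting_cocycle[OF f ft(1)] ft(2) by blast
  then have h': "loc_cochain (Suc (Suc m)) h"
    by (simp add: loc_cocycle_def)
  obtain V1 V2 V3 where V: "sym_nbhd V1" "continuous_on_box (Suc m) V1 f" "sym_nbhd V2"
    "continuous_on_box (Suc m) V2 ft" "sym_nbhd V3" "continuous_on_box (Suc (Suc m)) V3 h"
    using ex_sym_nbhd[OF f'] ex_sym_nbhd[OF ft(1)] ex_sym_nbhd[OF h'] by metis
  have "sym_nbhd (V1 \<inter> V2 \<inter> V3)"
    using V by (simp add: sym_nbhd_Int)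
  moreover have "continuous_on_box (Suc m) (V1 \<inter> V2 \<inter> V3) f"
    "continuous_on_box (Suc m) (V1 \<inter> V2 \<inter> V3) ft"
    "continuous_on_box (Suc (Suc m)) (V1 \<inter> V2 \<inter> V3) h"
    using V by (auto elim: continuous_on_box_mono)
  ultimately show ?thesis
    using that[of "V1 \<inter> V2 \<inter> V3" ft h] ft(2) h gp_connecting_class[OF f ft(1) ft(2) h] by simp
qed

lemma i_tau:
  assumes "\<forall>g\<in>tuples (Suc (Suc m)). i (h g) = gp_diff actB (Suc m) ft g"
  shows "i (tau actA (Suc (Suc m)) h g x) = cech_diff m (tau actB (Suc m) ft) g x"
proof -
  have "i (tau actA (Suc (Suc m)) h g x) = tau actB (Suc (Suc m)) (gp_diff actB (Suc m) ft) g x"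
    unfolding module_morphism_tau[OF mor_i] by (rule tau_cong) (use assms in blast)
  then show ?thesis
    by (simp add: tau_gp_diff[OF modB])
qed

text \<open>The continuous Cech lift is \<open>tau\<close> ft, whose differential is i applied to
  \<open>tau\<close> h by \<open>i_tau\<close>. It lives on the translates of V', to which the class
  of \<open>tau\<close> f is moved from V through the intersection W.\<close>

lemma cech_connecting_tau:
  assumes f: "loc_cocycle actC (Suc m) f" and V: "tau_nbhds (Suc m) f U V"
  shows "cech_connecting i p m (cech_class m (translates V) (tau actC (Suc m) f))
    (tau_map actA (Suc (Suc m)) (gp_connecting actA actB i p (Suc m) (loc_class actC (Suc m) f)))"
proof -
  obtain ft h V' where V': "sym_nbhd V'" "continuous_on_box (Suc m) V' f" "continuous_on_box (Suc m) V' ft"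
    "continuous_on_box (Suc (Suc m)) V' h" and ft: "\<forall>g. p (ft g) = f g"
    and h: "loc_cocycle actA (Suc (Suc m)) h" "\<forall>g\<in>tuples (Suc (Suc m)). i (h g) = gp_diff actB (Suc m) ft g"
    and conn: "gp_connecting actA actB i p (Suc m) (loc_class actC (Suc m) f) = loc_class actA (Suc (Suc m)) h"
    by (rule connecting_data[OF f]) (rule that)
  note nbhds_f = sym_nbhd_tau_nbhds[OF V'(1,2)] and nbhds_h = sym_nbhd_tau_nbhds[OF V'(1,4)]
  have refl: "(f, f) \<in> loc_cohomologous actC (Suc m)"
    using loc_class_self[OF modC f] by (simp add: loc_class_def)
  define W where "W = V \<inter> V'"
  have W: "open_cover (translates W)"
    using V V' by (intro open_cover_translates) (auto simp: W_def tau_nbhds_def sym_nbhd_def)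
  have "cech_class m (translates V) (tau actC (Suc m) f) = cech_class m (translates W) (tau actC (Suc m) f)"
    by (rule cech_class_mono[OF cech_cocycle_tau[OF modC f V] W translates_mono]) (simp add: W_def)
  also have "\<dots> = cech_class m (translates V') (tau actC (Suc m) f)"
    by (rule cech_class_mono[OF cech_cocycle_tau[OF modC f nbhds_f] W translates_mono, symmetric]) (simp add: W_def)
  finally have class_f: "cech_class m (translates V) (tau actC (Suc m) f) = cech_class m (translates V') (tau actC (Suc m) f)" .
  have "cech_lift i p m (translates V') (tau actC (Suc m) f) (tau actB (Suc m) ft) (tau actA (Suc (Suc m)) h)"
    unfolding cech_lift_def
    using cech_cocycle_tau(2)[OF modC f nbhds_f] cech_cocycle_tau(2)[OF modA h(1) nbhds_h]
      cech_cochain_tau[OF modB V'(1,3)] i_tau[OF h(2)]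
    by (simp add: module_morphism_tau[OF mor_p] ft)
  then show ?thesis
    unfolding cech_connecting_def conn class_f tau_map_class[OF modA disjI1[OF zero_less_Suc] h(1) nbhds_h]
    using cech_cocycle_tau(1)[OF modC f nbhds_f] by blast
qed

text \<open>An arbitrary lift b is compared with \<open>tau\<close> ft on the translates of W: p
  annihilates the difference, so it equals i e for a continuous e, and d e is the difference of
  \<open>tau\<close> h and a.\<close>

lemma cech_lift_tau_unique:
  assumes f: "loc_cocycle actC (Suc m) f" and V: "tau_nbhds (Suc m) f U V"
    and lift: "cech_lift i p m (translates V) (tau actC (Suc m) f) b a"
  shows "cech_class (Suc m) (translates V) a
    = tau_map actA (Suc (Suc m)) (gp_connecting actA actB i p (Suc m) (loc_class actC (Suc m) f))"
proof -
  obtain ft h V' where V': "sym_nbhd V'" "continuous_on_box (Suc m) V' f" "continuous_on_box (Suc m) V' ft"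
    "continuous_on_box (Suc (Suc m)) V' h" and ft: "\<forall>g. p (ft g) = f g"
    and h: "loc_cocycle actA (Suc (Suc m)) h" "\<forall>g\<in>tuples (Suc (Suc m)). i (h g) = gp_diff actB (Suc m) ft g"
    and conn: "gp_connecting actA actB i p (Suc m) (loc_class actC (Suc m) f) = loc_class actA (Suc (Suc m)) h"
    by (rule connecting_data[OF f]) (rule that)
  note nbhds_h = sym_nbhd_tau_nbhds[OF V'(1,4)]
  note tau_h = cech_cocycle_tau[OF modA h(1) nbhds_h]
  let ?f = "tau actC (Suc m) f" and ?ft = "tau actB (Suc m) ft" and ?h = "tau actA (Suc (Suc m)) h"
  define W where "W = V \<inter> V'"
  have W: "open_cover (translates W)"
    using V V' by (intro open_cover_translates) (auto simp: W_def tau_nbhds_def sym_nbhd_def)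
  have mono: "translates W g \<subseteq> translates V g" "translates W g \<subseteq> translates V' g" for g
    by (auto simp: W_def mem_translates)
  have V_cover: "open_cover (translates V)"
    using cech_cocycle_tau[OF modC f V] by blast
  have b: "cech_cochain (translates V) m b" and a: "cech_cocycle (translates V) (Suc m) a"
    and pb: "\<And>g x. g \<in> tuples (Suc m) \<Longrightarrow> x \<in> cech_inter (translates V) m g \<Longrightarrow> p (b g x) = ?f g x"
    and ia: "\<And>g x. g \<in> tuples (Suc (Suc m)) \<Longrightarrow> x \<in> cech_inter (translates V) (Suc m) g \<Longrightarrow> i (a g x) = cech_diff m b g x"
    using lift by (auto simp: cech_lift_def)
  obtain r S where r: "open S" "range i \<subseteq> S" "continuous_on S r" "\<forall>a. r (i a) = a"
    by (rule local_retraction) (rule that)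
  \<comment> \<open>On the intersections of the cover by translates of W the argument of r lies in
    the range of i, hence in S. Elsewhere the value of e is irrelevant.\<close>
  define e where "e g x = r (?ft g x - b g x)" for g x
  have range: "?ft g x - b g x \<in> range i" if "g \<in> tuples (Suc m)" "x \<in> cech_inter (translates W) m g" for g x
    using that pb[OF that(1)] subsetD[OF cech_inter_mono[OF mono(1)]]
    by (simp add: range_i p.diff module_morphism_tau[OF mor_p] ft)
  have ie: "i (e g x) = ?ft g x - b g x" if "g \<in> tuples (Suc m)" "x \<in> cech_inter (translates W) m g" for g x
    using range[OF that] r(4) by (auto simp: e_def)
  have "cech_cochain (translates W) m e"
    unfolding cech_cochain_def
  proof
    fix g :: "nat \<Rightarrow> 'g" assume g: "g \<in> tuples (Suc m)"
    have "continuous_on (cech_inter (translates W) m g) (\<lambda>x. ?ft g x - b g x)"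
      using cech_cochain_mono[OF b mono(1)] cech_cochain_mono[OF cech_cochain_tau[OF modB V'(1,3)] mono(2)] g
      by (auto simp: cech_cochain_def intro!: continuous_on_diff)
    then show "continuous_on (cech_inter (translates W) m g) (e g)"
      unfolding e_def[abs_def] using range[OF g] r(2)
      by (intro continuous_on_compose2[OF r(3)]) auto
  qed
  moreover have "?h g x - a g x = cech_diff m e g x"
    if g: "g \<in> tuples (Suc (Suc m))" and x: "x \<in> cech_inter (translates W) (Suc m) g" for g x
  proof -
    have "i (cech_diff m e g x) = cech_diff m (\<lambda>g x. ?ft g x - b g x) g x"
      unfolding additive_cech_diff[OF i.additive_axioms] by (rule cech_diff_cong[OF ie x])
    also have "\<dots> = i (?h g x - a g x)"
      using ia[OF g subsetD[OF cech_inter_mono[OF mono(1)] x]]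
      by (simp add: cech_diff_diff i.diff i_tau[OF h(2)])
    finally show ?thesis
      using inj_i by (simp add: inj_eq)
  qed
  ultimately have "cech_coboundary (translates W) (Suc m) (\<lambda>g x. ?h g x - a g x)"
    by (auto simp: cech_coboundary_def)
  then have "cech_class (Suc m) (translates W) a = cech_class (Suc m) (translates W) ?h"
    by (intro cech_class_step cech_step.cohomologous W cech_cocycle_mono[OF a mono(1)]
        cech_cocycle_mono[OF tau_h(2) mono(2)])
  then have "cech_class (Suc m) (translates V) a = cech_class (Suc m) (translates V') ?h"
    using cech_class_mono[OF V_cover a W mono(1)] cech_class_mono[OF tau_h W mono(2)] by simp
  then show ?thesis
    unfolding conn tau_map_class[OF modA disjI1[OF zero_less_Suc] h(1) nbhds_h] .
qed

end

lemma tau_map_in_cech_cohomology: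
  assumes act: "top_module act" and triv: "m > 0 \<or> (\<forall>g a. act g a = a)"
    and \<xi>: "\<xi> \<in> loc_cohomology act (Suc m)"
  shows "tau_map act (Suc m) \<xi> \<in> cech_cohomology m"
proof -
  obtain f where f: "loc_cocycle act (Suc m) f" "\<xi> = loc_class act (Suc m) f"
    using \<xi> by (rule loc_cohomologyE)
  then obtain U V where V: "tau_nbhds (Suc m) f U V"
    using ex_tau_nbhds[of "Suc m" f] unfolding loc_cocycle_def by blast
  show ?thesis
    unfolding f(2) tau_map_class[OF act triv f(1) V] cech_cohomology_def
    using cech_cocycle_tau[OF act f(1) V] by blast
qed

theorem proposition5p8:
  fixes actA :: "'g::topological_group_add \<Rightarrow> 'a::topological_ab_group_add \<Rightarrow> 'a"
    and n :: nat
  assumes "connected (UNIV :: 'g set)" and "top_module actA" and "1 \<le> n"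
  shows
    "(\<forall>f U V. loc_cocycle actA n f \<and> tau_nbhds n f U V \<longrightarrow>
        open_cover (translates V) \<and> cech_cocycle (translates V) (n - 1) (tau actA n f)) \<and>

     (2 \<le> n \<or> (\<forall>g a. actA g a = a) \<longrightarrow>
        (\<forall>\<xi>\<in>loc_cohomology actA n. tau_map actA n \<xi> \<in> cech_cohomology (n - 1)) \<and>
        (\<forall>f U V. loc_cocycle actA n f \<and> tau_nbhds n f U V \<longrightarrow>
           tau_map actA n (loc_class actA n f)
             = cech_class (n - 1) (translates V) (tau actA n f))) \<and>

     (\<forall>(actB :: 'g \<Rightarrow> 'b::topological_ab_group_add \<Rightarrow> 'b)
       (actC :: 'g \<Rightarrow> 'c::topological_ab_group_add \<Rightarrow> 'c) i p.
        short_exact actA actB actC i p \<longrightarrow>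
        (\<forall>\<xi>\<in>loc_cohomology actC n.
           gp_connecting actA actB i p n \<xi> \<in> loc_cohomology actA (Suc n)) \<and>
        (2 \<le> n \<or> (\<forall>g c. actC g c = c) \<longrightarrow>
           (\<forall>\<xi>\<in>loc_cohomology actC n.
              cech_connecting i p (n - 1) (tau_map actC n \<xi>)
                (tau_map actA (Suc n) (gp_connecting actA actB i p n \<xi>)))) \<and>
        (\<forall>f U V. loc_cocycle actC n f \<and> tau_nbhds n f U V \<longrightarrow>
           cech_connecting i p (n - 1) (cech_class (n - 1) (translates V) (tau actC n f))
             (tau_map actA (Suc n) (gp_connecting actA actB i p n (loc_class actC n f))) \<and>
           (\<forall>b a. cech_lift i p (n - 1) (translates V) (tau actC n f) b a \<longrightarrow>
              cech_class n (translates V) a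
                = tau_map actA (Suc n) (gp_connecting actA actB i p n (loc_class actC n f)))))"
proof -
  obtain m where n: "n = Suc m"
    using assms(3) by (cases n) auto
  \<comment> \<open>With n = Suc m the Cech degree is m, and the degrees in which coboundaries go to
    coboundaries for every action are those with m > 0.\<close>
  have triv: "2 \<le> n \<or> P \<longleftrightarrow> m > 0 \<or> P" for P
    by (auto simp: n)
  show ?thesis
    unfolding triv unfolding n diff_Suc_1
  proof (intro conjI allI impI ballI, goal_cases)
    case (1 f U V)
    then show ?case
      using cech_cocycle_tau[OF assms(2)] by blast
  next
    case (2 f U V)
    then show ?case
      using cech_cocycle_tau[OF assms(2)] by blast
  next
    case (3 \<xi>)
    then show ?case
      using tau_map_in_cech_cohomology[OF assms(2)] by blast
  next
    case (4 f U V)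
    then show ?case
      using tau_map_class[OF assms(2)] by blast
  next
    case (5 actB actC i p \<xi>)
    then interpret short_exact_modules actA actB actC i p
      by unfold_locales
    obtain f where f: "loc_cocycle actC (Suc m) f" "\<xi> = loc_class actC (Suc m) f"
      using 5(2) by (rule loc_cohomologyE)
    show ?case
      unfolding f(2) by (rule connecting_data[OF f(1)]) (simp add: loc_class_in_cohomology)
  next
    case (6 actB actC i p \<xi>)
    then interpret short_exact_modules actA actB actC i p
      by unfold_locales
    obtain f where f: "loc_cocycle actC (Suc m) f" "\<xi> = loc_class actC (Suc m) f"
      using 6(3) by (rule loc_cohomologyE)
    then obtain U V where V: "tau_nbhds (Suc m) f U V"
      using ex_tau_nbhds[of "Suc m" f] unfolding loc_cocycle_def by blast
    show ?case
      using cech_connecting_tau[OF f(1) V] by (simp add: f(2) tau_map_class[OF modC 6(2) f(1) V])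
  next
    case (7 actB actC i p f U V)
    then interpret short_exact_modules actA actB actC i p
      by unfold_locales
    show ?case
      using cech_connecting_tau 7(2) by blast
  next
    case (8 actB actC i p f U V b a)
    then interpret short_exact_modules actA actB actC i p
      by unfold_locales
    show ?case
      using cech_lift_tau_unique 8(2,3) by blast
  qed
qed

end
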